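(* Let $G$ be a locally compact abelian group, $X$ an operator space, and $\nu\in M_{ac}(G\times\widehat G;X)$. Let $1\le p<\infty$, $f\in L^p(G\times\widehat G)$ and $g\in L^1_w(G\times\widehat G,\nu)$ be such that, for $m_{G\times\widehat G}$-a.e. $(x,\chi)\in G\times\widehat G$, the mapping $(x',\chi')\mapsto f(xx'^{-1},\chi\overline{\chi'})\,g(x',\chi')\,\chi'(xx'^{-1})$ belongs to $L^1(G\times\widehat G,\nu)$. Then for every $x^*\in X^*$, $$f\times_\nu g(x^* )=\langle f\times^\nu g,x^*\rangle$$ ($m_{G\times\widehat G}$-almost everywhere).
   Context: $\widehat G$ is the dual group of $G$ and $m_{G\times\widehat G}$ the Haar measure on $G\times\widehat G$. $M_{ac}(G\times\widehat G;X)$ is the space of $\sigma$-additive regular $X$-valued vector measures on the Borel sets of $G\times\widehat G$ that are absolutely continuous with respect to $m_{G\times\widehat G}$; for $x^*\in X^*$, $h_{x^*}\in L^1(G\times\widehat G)$ is the Radon–Nikodym derivative $d\langle\nu,x^*\rangle/dm_{G\times\widehat G}$. A measurable scalar function $g$ is in $L^1_w(G\times\widehat G,\nu)$ ($\nu$-weakly integrable) if $\sup_{\|x^*\|\le1}\int|g|\,d|\langle\nu,x^*\rangle|<\infty$; it is in $L^1(G\times\widehat G,\nu)$ ($\nu$-integrable) if moreover for every Borel set $B$ there is a (unique) element $\int_Bg\,d\nu\in X$ with $\langle\int_Bg\,d\nu,x^*\rangle=\int_Bg\,d\langle\nu,x^*\rangle$ for all $x^*\in X^*$. The (scalar) twisted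 convolution of $f$ and $k$ is $f\times k(x,\chi)=\int_{G\times\widehat G}f(xx'^{-1},\chi\overline{\chi'})\,k(x',\chi')\,\chi'(xx'^{-1})\,dm_{G\times\widehat G}(x',\chi')$. Define $f\times_\nu g(x^* ):=f\times(g\,h_{x^*})$ for $x^*\in X^*$ (here $gh_{x^*}\in L^1(G\times\widehat G)$, so this is well defined in $L^p(G\times\widehat G)$). Define the $X$-valued function $$f\times^\nu g(x,\chi):=\int_{G\times\widehat G}f(xx'^{-1},\chi\overline{\chi'})\,g(x',\chi')\,\chi'(xx'^{-1})\,d\nu(x',\chi')$$ for those $(x,\chi)$ for which the integrand is in $L^1(G\times\widehat G,\nu)$. *)

theory Defs
  imports "HOL-Analysis.Analysis"
begin

section \<open>The dual group\<close>

text \<open>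
  Abelian topological groups are written additively, as in the library: $xy^{-1}$ is
  \<open>x - y\<close>. Likewise for the dual group, whose operations are the pointwise ones on
  characters, so that $\gamma\overline{\psi}$ is \<open>\<gamma> - \<psi>\<close>.
\<close>

typedef (overloaded) ('g::topological_ab_group_add) dual_group =
  "{\<gamma> :: 'g \<Rightarrow> complex. continuous_on UNIV \<gamma> \<and> (\<forall>x. cmod (\<gamma> x) = 1) \<and>
      (\<forall>x y. \<gamma> (x + y) = \<gamma> x * \<gamma> y)}"
  morphisms char_eval Character
  by (rule exI[of _ "\<lambda>_. 1"]) simp

setup_lifting type_definition_dual_group

lemma dual_group_eqI: "(\<And>x. char_eval \<gamma> x = char_eval \<psi> x) \<Longrightarrow> \<gamma> = \<psi>"
  by (metis char_eval_inject ext)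

lemma continuous_char_eval: "continuous_on S (char_eval \<gamma>)"
  using char_eval[of \<gamma>] by (auto intro: continuous_on_subset)

lemma norm_char_eval [simp]: "cmod (char_eval \<gamma> x) = 1"
  using char_eval[of \<gamma>] by auto

lemma char_eval_add: "char_eval \<gamma> (x + y) = char_eval \<gamma> x * char_eval \<gamma> y"
  using char_eval[of \<gamma>] by auto

instantiation dual_group :: (topological_ab_group_add) ab_group_add
begin

lift_definition zero_dual_group :: "'a dual_group" is "\<lambda>_. 1"
  by simp

lift_definition plus_dual_group :: "'a dual_group \<Rightarrow> 'a dual_group \<Rightarrow> 'a dual_group"
  is "\<lambda>\<gamma> \<psi> x. \<gamma> x * \<psi> x"
  by (auto intro!: continuous_intros simp: norm_mult)

lift_definition uminus_dual_group :: "'a dual_group \<Rightarrow> 'a dual_group"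
  is "\<lambda>\<gamma> x. cnj (\<gamma> x)"
  by (auto intro!: continuous_intros)

lift_definition minus_dual_group :: "'a dual_group \<Rightarrow> 'a dual_group \<Rightarrow> 'a dual_group"
  is "\<lambda>\<gamma> \<psi> x. \<gamma> x * cnj (\<psi> x)"
  by (auto intro!: continuous_intros simp: norm_mult)

instance
proof
  fix a b c :: "'a dual_group"
  show "a + b + c = a + (b + c)" by transfer (simp add: mult.assoc)
  show "a + b = b + a" by transfer (simp add: mult.commute)
  show "0 + a = a" by transfer simp
  show "- a + a = 0"
  proof (rule dual_group_eqI)
    fix x
    have "char_eval a x * cnj (char_eval a x) = 1"
      by (simp add: complex_norm_square[symmetric])
    then show "char_eval (- a + a) x = char_eval 0 x"
      by (simp add: plus_dual_group.rep_eq uminus_dual_group.rep_eq zero_dual_group.rep_eq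
          mult.commute)
  qed
  show "a - b = a + - b" by transfer simp
qed

end

text \<open>The topology of uniform convergence on compact sets.\<close>

definition char_nbhd ::
  "'g::topological_ab_group_add dual_group \<Rightarrow> 'g set \<Rightarrow> real \<Rightarrow> 'g dual_group set" where
  "char_nbhd \<gamma> K e = {\<psi>. \<forall>x\<in>K. cmod (char_eval \<psi> x - char_eval \<gamma> x) < e}"

instantiation dual_group :: (topological_ab_group_add) topological_space
begin

definition open_dual_group :: "'a dual_group set \<Rightarrow> bool" where
  "open_dual_group S \<longleftrightarrow> (\<forall>\<gamma>\<in>S. \<exists>K e. compact K \<and> 0 < e \<and> char_nbhd \<gamma> K e \<subseteq> S)"

instance
proof
  show "open (UNIV :: 'a dual_group set)"
    unfolding open_dual_group_def by (auto intro!: exI[of _ "{}"] exI[of _ 1])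
next
  fix S T :: "'a dual_group set" assume S: "open S" and T: "open T"
  show "open (S \<inter> T)"
    unfolding open_dual_group_def
  proof
    fix \<gamma> assume "\<gamma> \<in> S \<inter> T"
    then obtain K e L d where "compact K" "0 < e" "char_nbhd \<gamma> K e \<subseteq> S"
      and "compact L" "0 < d" "char_nbhd \<gamma> L d \<subseteq> T"
      using S T unfolding open_dual_group_def by (metis IntE)
    then show "\<exists>K e. compact K \<and> 0 < e \<and> char_nbhd \<gamma> K e \<subseteq> S \<inter> T"
      by (intro exI[of _ "K \<union> L"] exI[of _ "min e d"]) (auto simp: char_nbhd_def)
  qed
next
  fix C :: "'a dual_group set set" assume C: "\<forall>S\<in>C. open S"
  show "open (\<Union>C)"
    unfolding open_dual_group_def
  proof
    fix \<gamma> assume "\<gamma> \<in> \<Union>C"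
    then obtain S where "S \<in> C" "\<gamma> \<in> S" by auto
    with C obtain K e where "compact K" "0 < e" "char_nbhd \<gamma> K e \<subseteq> S"
      unfolding open_dual_group_def by metis
    with \<open>S \<in> C\<close> show "\<exists>K e. compact K \<and> 0 < e \<and> char_nbhd \<gamma> K e \<subseteq> \<Union>C"
      by blast
  qed
qed

end

lemma char_nbhd_self: "0 < e \<Longrightarrow> \<gamma> \<in> char_nbhd \<gamma> K e"
  by (simp add: char_nbhd_def)

lemma open_char_nbhd:
  assumes K: "compact K"
  shows "open (char_nbhd \<gamma> K e)"
  unfolding open_dual_group_def
proof
  fix \<psi> assume \<psi>: "\<psi> \<in> char_nbhd \<gamma> K e"
  show "\<exists>L d. compact L \<and> 0 < d \<and> char_nbhd \<psi> L d \<subseteq> char_nbhd \<gamma> K e"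
  proof (cases "K = {}")
    case True
    then show ?thesis by (intro exI[of _ "{}"] exI[of _ 1]) (auto simp: char_nbhd_def)
  next
    case False
    have "continuous_on K (\<lambda>x. cmod (char_eval \<psi> x - char_eval \<gamma> x))"
      by (intro continuous_intros continuous_char_eval)
    from continuous_attains_sup[OF K False this] obtain z where z: "z \<in> K"
      "\<And>x. x \<in> K \<Longrightarrow> cmod (char_eval \<psi> x - char_eval \<gamma> x) \<le> cmod (char_eval \<psi> z - char_eval \<gamma> z)"
      by blast
    define d where "d = e - cmod (char_eval \<psi> z - char_eval \<gamma> z)"
    have "0 < d" using \<psi> z by (auto simp: char_nbhd_def d_def)
    moreover have "char_nbhd \<psi> K d \<subseteq> char_nbhd \<gamma> K e"
    proof
      fix \<phi> assume \<phi>: "\<phi> \<in> char_nbhd \<psi> K d"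
      have "cmod (char_eval \<phi> x - char_eval \<gamma> x) < e" if "x \<in> K" for x
      proof -
        have "cmod (char_eval \<phi> x - char_eval \<gamma> x)
            \<le> cmod (char_eval \<phi> x - char_eval \<psi> x) + cmod (char_eval \<psi> x - char_eval \<gamma> x)"
          by norm
        also have "\<dots> < e"
          using \<phi> z(2)[OF that] that by (force simp: char_nbhd_def d_def)
        finally show ?thesis .
      qed
      then show "\<phi> \<in> char_nbhd \<gamma> K e" by (simp add: char_nbhd_def)
    qed
    ultimately show ?thesis using K by blast
  qed
qed

lemma eventually_char_nbhd:
  assumes "compact K" "0 < e"
  shows "eventually (\<lambda>\<psi>. \<psi> \<in> char_nbhd \<gamma> K e) (nhds \<gamma>)"
  using open_char_nbhd[OF assms(1)] char_nbhd_self[OF assms(2)] eventually_nhds by blast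

lemma filterlim_dual_groupI:
  assumes "\<And>K e. compact K \<Longrightarrow> 0 < e \<Longrightarrow> eventually (\<lambda>z. F z \<in> char_nbhd \<gamma> K e) A"
  shows "filterlim F (nhds \<gamma>) A"
proof (rule topological_tendstoI)
  fix S :: "'a dual_group set" assume "open S" "\<gamma> \<in> S"
  then obtain K e where K: "compact K" "0 < e" "char_nbhd \<gamma> K e \<subseteq> S"
    unfolding open_dual_group_def by metis
  then show "eventually (\<lambda>z. F z \<in> S) A"
    using assms[OF K(1,2)] by (auto elim!: eventually_mono)
qed

instance dual_group :: (topological_ab_group_add) t2_space
proof
  fix \<gamma> \<psi> :: "'a dual_group" assume "\<gamma> \<noteq> \<psi>"
  then obtain x where x: "char_eval \<gamma> x \<noteq> char_eval \<psi> x"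
    using dual_group_eqI by blast
  define e where "e = cmod (char_eval \<gamma> x - char_eval \<psi> x) / 2"
  have "0 < e" using x by (simp add: e_def)
  have "char_nbhd \<gamma> {x} e \<inter> char_nbhd \<psi> {x} e = {}"
  proof (rule equals0I)
    fix \<phi> assume "\<phi> \<in> char_nbhd \<gamma> {x} e \<inter> char_nbhd \<psi> {x} e"
    then have "cmod (char_eval \<phi> x - char_eval \<gamma> x) + cmod (char_eval \<phi> x - char_eval \<psi> x) < 2 * e"
      by (auto simp: char_nbhd_def)
    moreover have "2 * e \<le> cmod (char_eval \<phi> x - char_eval \<gamma> x) + cmod (char_eval \<phi> x - char_eval \<psi> x)"
      unfolding e_def by norm
    ultimately show False by simp
  qed
  then show "\<exists>U V. open U \<and> open V \<and> \<gamma> \<in> U \<and> \<psi> \<in> V \<and> U \<inter> V = {}"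
    using open_char_nbhd[of "{x}"] char_nbhd_self[OF \<open>0 < e\<close>] by (metis compact_sing)
qed

instance dual_group :: (topological_ab_group_add) topological_ab_group_add
proof
  fix a b :: "'a dual_group"
  show "((\<lambda>z. fst z + snd z) \<longlongrightarrow> a + b) (nhds a \<times>\<^sub>F nhds b)"
  proof (rule filterlim_dual_groupI)
    fix K :: "'a set" and e :: real assume K: "compact K" and e: "0 < e"
    have "eventually (\<lambda>z. fst z \<in> char_nbhd a K (e/2) \<and> snd z \<in> char_nbhd b K (e/2))
        (nhds a \<times>\<^sub>F nhds b)"
      by (intro eventually_prodI eventually_char_nbhd K half_gt_zero e)
    then show "eventually (\<lambda>z. fst z + snd z \<in> char_nbhd (a + b) K e) (nhds a \<times>\<^sub>F nhds b)"
    proof (rule eventually_mono)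
      fix z assume z: "fst z \<in> char_nbhd a K (e/2) \<and> snd z \<in> char_nbhd b K (e/2)"
      have "cmod (char_eval (fst z + snd z) x - char_eval (a + b) x) < e" if "x \<in> K" for x
      proof -
        let ?u = "char_eval (fst z) x" and ?v = "char_eval (snd z) x"
        let ?a = "char_eval a x" and ?b = "char_eval b x"
        have "?u * ?v - ?a * ?b = ?u * (?v - ?b) + (?u - ?a) * ?b"
          by (simp add: algebra_simps)
        then have "cmod (?u * ?v - ?a * ?b) \<le> cmod (?u * (?v - ?b)) + cmod ((?u - ?a) * ?b)"
          by (simp only: norm_triangle_ineq)
        also have "\<dots> = cmod (?v - ?b) + cmod (?u - ?a)"
          by (simp only: norm_mult norm_char_eval mult_1 mult_1_right)
        also have "\<dots> < e" using z that by (force simp: char_nbhd_def)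
        finally show ?thesis by (simp add: plus_dual_group.rep_eq)
      qed
      then show "fst z + snd z \<in> char_nbhd (a + b) K e" by (simp add: char_nbhd_def)
    qed
  qed
next
  fix a :: "'a dual_group"
  show "(uminus \<longlongrightarrow> - a) (nhds a)"
  proof (rule filterlim_dual_groupI)
    fix K :: "'a set" and e :: real assume "compact K" "0 < e"
    from eventually_char_nbhd[OF this, of a]
    show "eventually (\<lambda>z. - z \<in> char_nbhd (- a) K e) (nhds a)"
      by (rule eventually_mono)
         (simp add: char_nbhd_def uminus_dual_group.rep_eq flip: complex_cnj_diff)
  qed
qed

section \<open>Haar measure and Lebesgue spaces\<close>

definition haar_measure :: "'a::{topological_space, ab_group_add} measure \<Rightarrow> bool" where
  "haar_measure m \<longleftrightarrow>
     sets m = sets borel \<and>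
     emeasure m UNIV \<noteq> 0 \<and>
     (\<forall>a. \<forall>A\<in>sets borel. emeasure m ((+) a ` A) = emeasure m A) \<and>
     (\<forall>K. compact K \<longrightarrow> emeasure m K < \<infinity>) \<and>
     (\<forall>A\<in>sets borel. emeasure m A = (INF U\<in>{U. open U \<and> A \<subseteq> U}. emeasure m U)) \<and>
     (\<forall>U. open U \<longrightarrow> emeasure m U = (SUP K\<in>{K. compact K \<and> K \<subseteq> U}. emeasure m K))"

definition Lp :: "'a measure \<Rightarrow> real \<Rightarrow> ('a \<Rightarrow> complex) set" where
  "Lp m p = {f \<in> borel_measurable m. integrable m (\<lambda>z. cmod (f z) powr p)}"

section \<open>Operator spaces\<close>

class scaleC =
  fixes scaleC :: "complex \<Rightarrow> 'a \<Rightarrow> 'a" (infixr "*\<^sub>C" 75)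

class complex_normed_vector = real_normed_vector + scaleC +
  assumes scaleC_add_right: "a *\<^sub>C (x + y) = a *\<^sub>C x + a *\<^sub>C y"
    and scaleC_add_left: "(a + b) *\<^sub>C x = a *\<^sub>C x + b *\<^sub>C x"
    and scaleC_scaleC: "a *\<^sub>C b *\<^sub>C x = (a * b) *\<^sub>C x"
    and scaleC_of_real: "complex_of_real r *\<^sub>C x = r *\<^sub>R x"
    and norm_scaleC: "norm (a *\<^sub>C x) = cmod a * norm x"

text \<open>
  A matrix is a function of two indices of which only the entries within the stated
  dimensions are relevant. The norm of a scalar $m \times n$ matrix is its operator norm
  $\ell^2_n \to \ell^2_m$.
\<close>

definition cmat_norm :: "nat \<Rightarrow> nat \<Rightarrow> (nat \<Rightarrow> nat \<Rightarrow> complex) \<Rightarrow> real" where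
  "cmat_norm m n \<alpha> =
     (SUP z\<in>{z :: nat \<Rightarrow> complex. (\<Sum>j<n. (cmod (z j))\<^sup>2) \<le> 1}.
        sqrt (\<Sum>i<m. (cmod (\<Sum>j<n. \<alpha> i j * z j))\<^sup>2))"

text \<open>
  Operator spaces in the sense of Ruan's axioms: \<open>matnorm n\<close> is the norm on $M_n(X)$.
  Completeness is not part of the axioms.
\<close>

class operator_space = complex_normed_vector +
  fixes matnorm :: "nat \<Rightarrow> (nat \<Rightarrow> nat \<Rightarrow> 'a) \<Rightarrow> real"
  assumes matnorm_cong:
      "(\<And>i j. i < n \<Longrightarrow> j < n \<Longrightarrow> v i j = w i j) \<Longrightarrow> matnorm n v = matnorm n w"
    and matnorm_eq_0_iff: "matnorm n v = 0 \<longleftrightarrow> (\<forall>i<n. \<forall>j<n. v i j = 0)"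
    and matnorm_triangle: "matnorm n (\<lambda>i j. v i j + w i j) \<le> matnorm n v + matnorm n w"
    and matnorm_scaleC: "matnorm n (\<lambda>i j. a *\<^sub>C v i j) = cmod a * matnorm n v"
    and matnorm_1: "matnorm 1 v = norm (v 0 0)"
    and matnorm_direct_sum:
      "matnorm (m + n) (\<lambda>i j. if i < m \<and> j < m then v i j
                              else if m \<le> i \<and> m \<le> j then w (i - m) (j - m) else 0)
         = max (matnorm m v) (matnorm n w)"
    and matnorm_bimodule:
      "matnorm n (\<lambda>i j. \<Sum>k<m. \<Sum>l<m. (\<alpha> i k * \<beta> l j) *\<^sub>C v k l)
         \<le> cmat_norm n m \<alpha> * matnorm m v * cmat_norm m n \<beta>"

definition complex_dual :: "('x::complex_normed_vector \<Rightarrow> complex) set" where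
  "complex_dual = {\<phi>. bounded_linear \<phi> \<and> (\<forall>c x. \<phi> (c *\<^sub>C x) = c * \<phi> x)}"

section \<open>Complex measures\<close>

text \<open>
  Complex and vector measures are set functions, considered on Borel sets only.
  For a complex measure, the set functions handed to \<^const>\<open>measure_of\<close> below are
  countably additive.
\<close>

definition variation :: "('a::topological_space set \<Rightarrow> complex) \<Rightarrow> 'a set \<Rightarrow> ennreal" where
  "variation \<mu> A =
     (SUP P\<in>{P. finite P \<and> P \<subseteq> sets borel \<and> partition_on A P}. \<Sum>B\<in>P. ennreal (cmod (\<mu> B)))"

definition variation_measure :: "('a::topological_space set \<Rightarrow> complex) \<Rightarrow> 'a measure" where
  "variation_measure \<mu> = measure_of UNIV (sets borel) (variation \<mu>)"

text \<open>The positive part in the Jordan decomposition; \<^const>\<open>ennreal\<close> truncates at 0.\<close>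

definition pos_measure :: "('a::topological_space set \<Rightarrow> real) \<Rightarrow> 'a measure" where
  "pos_measure \<mu> =
     measure_of UNIV (sets borel) (\<lambda>A. SUP B\<in>{B \<in> sets borel. B \<subseteq> A}. ennreal (\<mu> B))"

definition signed_integral ::
  "('a::topological_space set \<Rightarrow> real) \<Rightarrow> ('a \<Rightarrow> complex) \<Rightarrow> complex" where
  "signed_integral \<mu> g =
     (LINT z|pos_measure \<mu>. g z) - (LINT z|pos_measure (\<lambda>A. - \<mu> A). g z)"

definition complex_measure_integral ::
  "('a::topological_space set \<Rightarrow> complex) \<Rightarrow> ('a \<Rightarrow> complex) \<Rightarrow> complex" where
  "complex_measure_integral \<mu> g =
     signed_integral (\<lambda>A. Re (\<mu> A)) g + \<i> * signed_integral (\<lambda>A. Im (\<mu> A)) g"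

definition complex_RN_deriv :: "'a measure \<Rightarrow> ('a set \<Rightarrow> complex) \<Rightarrow> 'a \<Rightarrow> complex" where
  "complex_RN_deriv m \<mu> =
     (SOME h. integrable m h \<and> (\<forall>A\<in>sets m. \<mu> A = (LINT z:A|m. h z)))"

section \<open>Vector measures\<close>

definition vector_measure ::
  "('a::topological_space set \<Rightarrow> 'x::complex_normed_vector) \<Rightarrow> bool" where
  "vector_measure \<nu> \<longleftrightarrow>
     (\<forall>A :: nat \<Rightarrow> 'a set. range A \<subseteq> sets borel \<longrightarrow> disjoint_family A \<longrightarrow>
        (\<lambda>i. \<nu> (A i)) sums \<nu> (\<Union>i. A i))"

definition semivariation ::
  "('a::topological_space set \<Rightarrow> 'x::complex_normed_vector) \<Rightarrow> 'a set \<Rightarrow> ennreal" where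
  "semivariation \<nu> A =
     (SUP \<phi>\<in>{\<phi> \<in> complex_dual. onorm \<phi> \<le> 1}. variation (\<lambda>B. \<phi> (\<nu> B)) A)"

definition regular_vector_measure ::
  "('a::topological_space set \<Rightarrow> 'x::complex_normed_vector) \<Rightarrow> bool" where
  "regular_vector_measure \<nu> \<longleftrightarrow>
     (\<forall>A\<in>sets borel. \<forall>\<epsilon>>0. \<exists>K U. compact K \<and> open U \<and> K \<subseteq> A \<and> A \<subseteq> U \<and>
        semivariation \<nu> (U - K) < ennreal \<epsilon>)"

definition M_ac ::
  "'a::topological_space measure \<Rightarrow> ('a set \<Rightarrow> 'x::complex_normed_vector) set" where
  "M_ac m = {\<nu>. vector_measure \<nu> \<and> regular_vector_measure \<nu> \<and> (\<forall>A\<in>null_sets m. \<nu> A = 0)}"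

definition L1_weak ::
  "('a::topological_space set \<Rightarrow> 'x::complex_normed_vector) \<Rightarrow> ('a \<Rightarrow> complex) set" where
  "L1_weak \<nu> = {g \<in> borel_measurable borel.
     (SUP \<phi>\<in>{\<phi> \<in> complex_dual. onorm \<phi> \<le> 1}.
        \<integral>\<^sup>+ z. ennreal (cmod (g z)) \<partial>variation_measure (\<lambda>B. \<phi> (\<nu> B))) < \<infinity>}"

definition is_vector_integral ::
  "('a::topological_space set \<Rightarrow> 'x::complex_normed_vector) \<Rightarrow> 'a set \<Rightarrow> ('a \<Rightarrow> complex) \<Rightarrow> 'x \<Rightarrow> bool"
  where
  "is_vector_integral \<nu> B g v \<longleftrightarrow>
     (\<forall>\<phi>\<in>complex_dual.
        \<phi> v = complex_measure_integral (\<lambda>A. \<phi> (\<nu> A)) (\<lambda>z. indicator B z * g z))"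

definition L1_vec ::
  "('a::topological_space set \<Rightarrow> 'x::complex_normed_vector) \<Rightarrow> ('a \<Rightarrow> complex) set" where
  "L1_vec \<nu> = {g \<in> L1_weak \<nu>. \<forall>B\<in>sets borel. \<exists>v. is_vector_integral \<nu> B g v}"

text \<open>
  By the Hahn-Banach theorem at most one vector satisfies \<^const>\<open>is_vector_integral\<close>, so no
  actual choice is made.
\<close>

definition vector_integral ::
  "('a::topological_space set \<Rightarrow> 'x::complex_normed_vector) \<Rightarrow> 'a set \<Rightarrow> ('a \<Rightarrow> complex) \<Rightarrow> 'x" where
  "vector_integral \<nu> B g = (SOME v. is_vector_integral \<nu> B g v)"

section \<open>Twisted convolutions\<close>

definition twisted_conv ::
  "('g::topological_ab_group_add \<times> 'g dual_group) measure \<Rightarrow>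
   ('g \<times> 'g dual_group \<Rightarrow> complex) \<Rightarrow> ('g \<times> 'g dual_group \<Rightarrow> complex) \<Rightarrow>
   'g \<times> 'g dual_group \<Rightarrow> complex" where
  "twisted_conv m f k = (\<lambda>(x, \<gamma>).
     LINT (x', \<gamma>')|m. f (x - x', \<gamma> - \<gamma>') * k (x', \<gamma>') * char_eval \<gamma>' (x - x'))"

definition twisted_conv_weak ::
  "('g::topological_ab_group_add \<times> 'g dual_group) measure \<Rightarrow>
   (('g \<times> 'g dual_group) set \<Rightarrow> 'x::complex_normed_vector) \<Rightarrow>
   ('g \<times> 'g dual_group \<Rightarrow> complex) \<Rightarrow> ('g \<times> 'g dual_group \<Rightarrow> complex) \<Rightarrow>
   ('x \<Rightarrow> complex) \<Rightarrow> 'g \<times> 'g dual_group \<Rightarrow> complex" where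
  "twisted_conv_weak m \<nu> f g \<phi> =
     twisted_conv m f (\<lambda>z. g z * complex_RN_deriv m (\<lambda>A. \<phi> (\<nu> A)) z)"

definition twisted_integrand ::
  "('g::topological_ab_group_add \<times> 'g dual_group \<Rightarrow> complex) \<Rightarrow>
   ('g \<times> 'g dual_group \<Rightarrow> complex) \<Rightarrow> 'g \<times> 'g dual_group \<Rightarrow>
   'g \<times> 'g dual_group \<Rightarrow> complex" where
  "twisted_integrand f g = (\<lambda>(x, \<gamma>) (x', \<gamma>').
     f (x - x', \<gamma> - \<gamma>') * g (x', \<gamma>') * char_eval \<gamma>' (x - x'))"

text \<open>Where the integrand is not in \<^const>\<open>L1_vec\<close>, the value is set to 0 by convention.\<close>

definition twisted_conv_vec ::
  "(('g::topological_ab_group_add \<times> 'g dual_group) set \<Rightarrow> 'x::complex_normed_vector) \<Rightarrow>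
   ('g \<times> 'g dual_group \<Rightarrow> complex) \<Rightarrow> ('g \<times> 'g dual_group \<Rightarrow> complex) \<Rightarrow>
   'g \<times> 'g dual_group \<Rightarrow> 'x" where
  "twisted_conv_vec \<nu> f g z =
     (if twisted_integrand f g z \<in> L1_vec \<nu>
      then vector_integral \<nu> UNIV (twisted_integrand f g z) else 0)"

end

(* Each functional turns the vector measure into a complex measure with a density h with respect to
   the Haar measure, and integrating against it is integrating against h dm. Hence the identity holds at every point where the
   integrand is integrable, without Fubini. The Haar measure may fail to be sigma-finite; regularity
   concentrates each scalar measure on a sigma-compact set, where the Radon-Nikodym theorem applies. *)

theory Submission
  imports Defs
begin

section \<open>Countably additive set functions\<close>

text \<open>The notions involved are set functions turned into measures by
  \<open>measure_of\<close>, which returns the zero measure unless the set function is positive and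
  countably additive. Before any integral can be computed, the Jordan parts must therefore be shown
  to be measures, and finite ones; their finiteness comes from countable additivity itself. Once a
  density \<open>h\<close> exists, \<open>pos_measure\<close> and \<open>variation_measure\<close>
  are recognised as densities of \<open>m\<close>. The second identification carries the
  integrability: \<open>L1_weak\<close> bounds integrals against variation measures, and knowing
  these to be |h| dm turns the bound into integrability of \<open>h\<close> times the integrand,
  without which Bochner integrals take a default value and cannot be split. Since
  \<open>complex_RN_deriv\<close> and \<open>vector_integral\<close> are Hilbert choices, nothing is
  known of them until existence is established: Radon-Nikodym does this for the first, membership in
  \<open>L1_vec\<close> for the second.\<close>

definition sigma_additive ::
  "'a measure \<Rightarrow> ('a set \<Rightarrow> 'b::real_normed_vector) \<Rightarrow> bool" where
  "sigma_additive M \<mu> \<longleftrightarrow>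
     (\<forall>A :: nat \<Rightarrow> 'a set. range A \<subseteq> sets M \<longrightarrow> disjoint_family A \<longrightarrow>
        (\<lambda>i. \<mu> (A i)) sums \<mu> (\<Union>i. A i))"

lemma sigma_additiveD:
  assumes "sigma_additive M \<mu>" "range A \<subseteq> sets M" "disjoint_family A"
  shows "(\<lambda>i. \<mu> (A i)) sums \<mu> (\<Union>i. A i)"
  using assms by (simp add: sigma_additive_def)

lemma sigma_additive_bounded_linear:
  assumes "bounded_linear f" "sigma_additive M \<mu>"
  shows "sigma_additive M (\<lambda>A. f (\<mu> A))"
  using assms(2) bounded_linear.sums[OF assms(1)] unfolding sigma_additive_def by blast

text \<open>A constant series converges only if its term is 0; additivity is applied to a sequence
  of empty pieces.\<close>

lemma sigma_additive_empty:
  assumes "sigma_additive M \<mu>"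
  shows "\<mu> {} = 0"
proof -
  have "(\<lambda>i::nat. \<mu> {}) sums \<mu> (\<Union>i::nat. {})"
    by (rule sigma_additiveD[OF assms]) (auto simp: disjoint_family_on_def)
  then have "summable (\<lambda>i::nat. \<mu> {})" by (rule sums_summable)
  then show ?thesis by (simp add: summable_const_iff)
qed

lemma sigma_additive_Un:
  assumes \<mu>: "sigma_additive M \<mu>" and A: "A \<in> sets M" and B: "B \<in> sets M" and AB: "A \<inter> B = {}"
  shows "\<mu> (A \<union> B) = \<mu> A + \<mu> B"
proof -
  have "(\<lambda>n. \<mu> (binaryset A B n)) sums \<mu> (\<Union>n. binaryset A B n)"
    by (rule sigma_additiveD[OF \<mu>])
       (use A B AB in \<open>auto simp: range_binaryset_eq disjoint_family_on_def binaryset_def\<close>)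
  moreover have "(\<lambda>n. \<mu> (binaryset A B n)) sums (\<mu> A + \<mu> B)"
    by (rule binaryset_sums) (rule sigma_additive_empty[OF \<mu>])
  ultimately show ?thesis by (metis UN_binaryset_eq sums_unique2)
qed

lemma sigma_additive_Diff:
  assumes \<mu>: "sigma_additive M \<mu>" and A: "A \<in> sets M" and B: "B \<in> sets M" and BA: "B \<subseteq> A"
  shows "\<mu> (A - B) = \<mu> A - \<mu> B"
proof -
  have "\<mu> (B \<union> (A - B)) = \<mu> B + \<mu> (A - B)"
    by (rule sigma_additive_Un[OF \<mu>]) (use A B in auto)
  moreover have "B \<union> (A - B) = A" using BA by auto
  ultimately show ?thesis by simp
qed

text \<open>
  If the set function is unbounded on \<open>E\<close>, then \<open>E\<close> splits into a piece of value larger than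
  1 and a piece on which it is still unbounded. Iterating gives disjoint pieces of value larger than 1,
  whose values cannot be summed.
\<close>

lemma sigma_additive_bounded:
  assumes \<mu>: "sigma_additive M \<mu>"
  obtains C where "\<And>A. A \<in> sets M \<Longrightarrow> norm (\<mu> A) \<le> C"
proof -
  define unbdd where
    "unbdd E \<longleftrightarrow> E \<in> sets M \<and> (\<forall>C. \<exists>B\<in>sets M. B \<subseteq> E \<and> C < norm (\<mu> B))" for E
  have split: "\<exists>F. unbdd F \<and> F \<subseteq> E \<and> 1 < norm (\<mu> (E - F))" if E: "unbdd E" for E
  proof -
    \<comment> \<open>The margin \<open>norm (\<mu> E)\<close> makes both \<mu> B and \<mu> (E - B)
      larger than 1 in norm, so whichever of the two pieces is still unbounded can be kept and the
      other one split off.\<close>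
    obtain B where B: "B \<in> sets M" "B \<subseteq> E" "1 + norm (\<mu> E) < norm (\<mu> B)"
      using E unfolding unbdd_def by blast
    have EM: "E \<in> sets M" using E unfolding unbdd_def by blast
    have D: "\<mu> (E - B) = \<mu> E - \<mu> B" by (rule sigma_additive_Diff[OF \<mu> EM B(1,2)])
    have "norm (\<mu> B) \<le> norm (\<mu> E) + norm (\<mu> (E - B))"
      unfolding D by norm
    then have D1: "1 < norm (\<mu> (E - B))" using B(3) by simp
    have "unbdd B \<or> unbdd (E - B)"
    proof (rule ccontr)
      assume "\<not> (unbdd B \<or> unbdd (E - B))"
      then obtain C1 C2 where C1: "\<And>A. A \<in> sets M \<Longrightarrow> A \<subseteq> B \<Longrightarrow> norm (\<mu> A) \<le> C1"
        and C2: "\<And>A. A \<in> sets M \<Longrightarrow> A \<subseteq> E - B \<Longrightarrow> norm (\<mu> A) \<le> C2"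
        using B(1) EM unfolding unbdd_def by (metis sets.Diff not_le)
      obtain A where A: "A \<in> sets M" "A \<subseteq> E" "C1 + C2 < norm (\<mu> A)"
        using E unfolding unbdd_def by blast
      have "\<mu> (A \<inter> B \<union> (A - B)) = \<mu> (A \<inter> B) + \<mu> (A - B)"
        by (rule sigma_additive_Un[OF \<mu>]) (use A B in auto)
      then have "\<mu> A = \<mu> (A \<inter> B) + \<mu> (A - B)" by (simp only: Int_Diff_Un)
      then have "norm (\<mu> A) \<le> norm (\<mu> (A \<inter> B)) + norm (\<mu> (A - B))"
        by (simp add: norm_triangle_ineq)
      also have "\<dots> \<le> C1 + C2"
        by (intro add_mono C1 C2) (use A B in auto)
      finally show False using A by simp
    qed
    then show ?thesis
    proof
      assume "unbdd B"
      with B D1 show ?thesis by blast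
    next
      assume "unbdd (E - B)"
      moreover have "E - (E - B) = B" using B by auto
      moreover have "1 < norm (\<mu> B)"
        using B(3) norm_ge_zero[of "\<mu> E"] by linarith
      ultimately show ?thesis by (metis Diff_subset)
    qed
  qed
  have "\<not> unbdd (space M)"
  proof
    assume "unbdd (space M)"
    then have "\<exists>E. \<forall>n::nat. unbdd (E n) \<and> (E (Suc n) \<subseteq> E n \<and> 1 < norm (\<mu> (E n - E (Suc n))))"
      using split by (intro dependent_nat_choice) auto
    then obtain E where E: "\<And>n::nat. unbdd (E n)" "\<And>n. E (Suc n) \<subseteq> E n"
      "\<And>n. 1 < norm (\<mu> (E n - E (Suc n)))" by blast
    have dec: "E n \<subseteq> E k" if "k \<le> n" for k n
      using that by (induction rule: dec_induct) (use E(2) in auto)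
    have "disjoint_family (\<lambda>n. E n - E (Suc n))"
      unfolding disjoint_family_on_def
    proof (intro ballI impI)
      fix i j :: nat assume "i \<noteq> j"
      then have "Suc i \<le> j \<or> Suc j \<le> i" by auto
      then show "(E i - E (Suc i)) \<inter> (E j - E (Suc j)) = {}" using dec by blast
    qed
    moreover have "range (\<lambda>n. E n - E (Suc n)) \<subseteq> sets M"
      using E(1) unfolding unbdd_def by blast
    ultimately have "summable (\<lambda>n. \<mu> (E n - E (Suc n)))"
      using sigma_additiveD[OF \<mu>] sums_summable by blast
    then have "(\<lambda>n. norm (\<mu> (E n - E (Suc n)))) \<longlonglongrightarrow> 0"
      using summable_LIMSEQ_zero tendsto_norm_zero by blast
    then have "(1::real) \<le> 0"
      by (rule LIMSEQ_le_const) (use E(3) less_imp_le in blast)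
    then show False by simp
  qed
  then obtain C where "\<And>B. B \<in> sets M \<Longrightarrow> norm (\<mu> B) \<le> C"
    unfolding unbdd_def by (metis not_le sets.sets_into_space sets.top)
  then show thesis by (rule that)
qed

section \<open>The Jordan decomposition\<close>

text \<open>Joining subsets of disjoint sets gives superadditivity, hence one inequality by
  induction and monotonicity; cutting a subset of the union along the \<open>A i\<close> gives the
  other.\<close>

lemma countably_additive_upper_part:
  fixes \<rho> :: "'a set \<Rightarrow> real"
  assumes \<rho>: "sigma_additive M \<rho>"
  shows "countably_additive (sets M) (\<lambda>A. SUP B\<in>{B \<in> sets M. B \<subseteq> A}. ennreal (\<rho> B))"
    (is "countably_additive _ ?P")
proof (rule countably_additiveI)
  fix A :: "nat \<Rightarrow> 'a set"
  assume A: "range A \<subseteq> sets M" "disjoint_family A" "(\<Union>i. A i) \<in> sets M"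
  have AM: "A i \<in> sets M" for i using A by auto
  have upper: "ennreal (\<rho> B) \<le> ?P C" if "B \<in> sets M" "B \<subseteq> C" for B C
    using that by (intro SUP_upper) auto
  have mono: "?P B \<le> ?P C" if "B \<subseteq> C" for B C
    using that by (intro SUP_subset_mono) auto
  have super: "?P B + ?P C \<le> ?P (B \<union> C)" if BC: "B \<inter> C = {}" for B C
  proof -
    have *: "ennreal (\<rho> D) + ennreal (\<rho> E) \<le> ?P (B \<union> C)"
      if D: "D \<in> sets M" "D \<subseteq> B" and E: "E \<in> sets M" "E \<subseteq> C" for D E
    proof -
      have U: "\<rho> (D \<union> E) = \<rho> D + \<rho> E"
        by (rule sigma_additive_Un[OF \<rho>]) (use D E BC in auto)
      \<comment> \<open>A piece of non-positive value counts as 0 after truncation. It must be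
        dropped rather than joined, since joining it could lower the value of the union.\<close>
      consider "\<rho> D \<le> 0" | "\<rho> E \<le> 0" | "0 \<le> \<rho> D" "0 \<le> \<rho> E" by linarith
      then show ?thesis
      proof cases
        case 1
        then have "ennreal (\<rho> D) + ennreal (\<rho> E) = ennreal (\<rho> E)" by (simp add: ennreal_neg)
        then show ?thesis using upper[OF E(1), of "B \<union> C"] E(2) by auto
      next
        case 2
        then have "ennreal (\<rho> D) + ennreal (\<rho> E) = ennreal (\<rho> D)" by (simp add: ennreal_neg)
        then show ?thesis using upper[OF D(1), of "B \<union> C"] D(2) by auto
      next
        case 3
        then have "ennreal (\<rho> D) + ennreal (\<rho> E) = ennreal (\<rho> (D \<union> E))" using U by simp
        then show ?thesis using upper[of "D \<union> E" "B \<union> C"] D E by auto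
      qed
    qed
    have "?P B + ?P C = (SUP D\<in>{D \<in> sets M. D \<subseteq> B}. ennreal (\<rho> D) + ?P C)"
      by (rule ennreal_SUP_add_left[symmetric]) auto
    also have "\<dots> \<le> ?P (B \<union> C)"
    proof (rule SUP_least)
      fix D assume D: "D \<in> {D \<in> sets M. D \<subseteq> B}"
      have "ennreal (\<rho> D) + ?P C = (SUP E\<in>{E \<in> sets M. E \<subseteq> C}. ennreal (\<rho> D) + ennreal (\<rho> E))"
        unfolding add.commute[of "ennreal (\<rho> D)"] by (rule ennreal_SUP_add_left[symmetric]) auto
      also have "\<dots> \<le> ?P (B \<union> C)"
        by (rule SUP_least) (use D * in auto)
      finally show "ennreal (\<rho> D) + ?P C \<le> ?P (B \<union> C)" .
    qed
    finally show ?thesis .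
  qed
  have fin: "(\<Sum>i<n. ?P (A i)) \<le> ?P (\<Union>i<n. A i)" for n
  proof (induction n)
    case 0
    show ?case by simp
  next
    case (Suc n)
    have "(\<Sum>i<Suc n. ?P (A i)) \<le> ?P (\<Union>i<n. A i) + ?P (A n)"
      using Suc by (simp add: add_right_mono)
    also have "\<dots> \<le> ?P ((\<Union>i<n. A i) \<union> A n)"
    proof (rule super)
      have "A i \<inter> A n = {}" if "i < n" for i
        using A(2) that by (auto simp: disjoint_family_on_def)
      then show "(\<Union>i<n. A i) \<inter> A n = {}" by blast
    qed
    also have "(\<Union>i<n. A i) \<union> A n = (\<Union>i<Suc n. A i)"
      by (auto simp: less_Suc_eq)
    finally show ?case .
  qed
  show "(\<Sum>i. ?P (A i)) = ?P (\<Union>i. A i)"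
  proof (rule antisym)
    show "(\<Sum>i. ?P (A i)) \<le> ?P (\<Union>i. A i)"
    proof (rule suminf_le_const[OF summableI])
      fix n
      show "(\<Sum>i<n. ?P (A i)) \<le> ?P (\<Union>i. A i)"
        by (rule order_trans[OF fin mono]) auto
    qed
    show "?P (\<Union>i. A i) \<le> (\<Sum>i. ?P (A i))"
    proof (rule SUP_least)
      fix B assume "B \<in> {B \<in> sets M. B \<subseteq> (\<Union>i. A i)}"
      then have B: "B \<in> sets M" "B \<subseteq> (\<Union>i. A i)" by auto
      have "(\<lambda>i. \<rho> (B \<inter> A i)) sums \<rho> (\<Union>i. B \<inter> A i)"
        by (rule sigma_additiveD[OF \<rho>]) (use A AM B in \<open>auto simp: disjoint_family_on_def\<close>)
      moreover have "(\<Union>i. B \<inter> A i) = B" using B by auto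
      ultimately have "(\<lambda>n. \<Sum>i<n. \<rho> (B \<inter> A i)) \<longlonglongrightarrow> \<rho> B" by (simp add: sums_def)
      then have "(\<lambda>n. ennreal (\<Sum>i<n. \<rho> (B \<inter> A i))) \<longlonglongrightarrow> ennreal (\<rho> B)"
        by (rule tendsto_ennrealI)
      moreover have "ennreal (\<Sum>i<n. \<rho> (B \<inter> A i)) \<le> (\<Sum>i. ?P (A i))" for n
      proof -
        \<comment> \<open>\<open>ennreal\<close> commutes with sums of non-negative terms only.
          Raising the negative terms to 0 keeps the upper bound valid and does not change
          \<open>ennreal\<close> of any single term.\<close>
        have "ennreal (\<Sum>i<n. \<rho> (B \<inter> A i)) \<le> ennreal (\<Sum>i<n. max 0 (\<rho> (B \<inter> A i)))"
          by (intro ennreal_leI sum_mono) auto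
        also have "\<dots> = (\<Sum>i<n. ennreal (max 0 (\<rho> (B \<inter> A i))))"
          by (subst sum_ennreal) auto
        also have "\<dots> = (\<Sum>i<n. ennreal (\<rho> (B \<inter> A i)))"
          by (simp add: ennreal_max_0)
        also have "\<dots> \<le> (\<Sum>i<n. ?P (A i))"
          by (intro sum_mono upper) (use B AM in auto)
        also have "\<dots> \<le> (\<Sum>i. ?P (A i))"
          by (rule sum_le_suminf) auto
        finally show ?thesis .
      qed
      ultimately show "ennreal (\<rho> B) \<le> (\<Sum>i. ?P (A i))"
        by (intro LIMSEQ_le_const2) auto
    qed
  qed
qed

lemma sets_pos_measure [simp, measurable_cong]: "sets (pos_measure \<rho>) = sets borel"
  unfolding pos_measure_def
  using sets.sigma_sets_eq[of borel] by (simp add: sets_measure_of_conv)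

lemma space_pos_measure [simp]: "space (pos_measure \<rho>) = UNIV"
  unfolding pos_measure_def by (simp add: space_measure_of_conv)

text \<open>Countable additivity of the supremum is what makes \<open>measure_of\<close> keep it
  instead of falling back to 0.\<close>

lemma emeasure_pos_measure:
  assumes \<rho>: "sigma_additive borel \<rho>" and A: "A \<in> sets borel"
  shows "emeasure (pos_measure \<rho>) A = (SUP B\<in>{B \<in> sets borel. B \<subseteq> A}. ennreal (\<rho> B))"
  unfolding pos_measure_def
proof (rule emeasure_measure_of_sigma)
  show "sigma_algebra UNIV (sets borel)"
    using sets.sigma_algebra_axioms[of borel] by simp
  show "positive (sets borel) (\<lambda>A. SUP B\<in>{B \<in> sets borel. B \<subseteq> A}. ennreal (\<rho> B))"
  proof -
    have "{B \<in> sets borel. B \<subseteq> {}} = {{} :: 'a set}" by auto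
    then show ?thesis by (simp add: positive_def sigma_additive_empty[OF \<rho>])
  qed
qed (use countably_additive_upper_part[OF \<rho>] A in auto)

lemma finite_measure_pos_measure:
  assumes \<rho>: "sigma_additive borel \<rho>"
  shows "finite_measure (pos_measure \<rho>)"
proof
  obtain C where C: "\<And>A. A \<in> sets borel \<Longrightarrow> norm (\<rho> A) \<le> C"
    using sigma_additive_bounded[OF \<rho>] by blast
  have "emeasure (pos_measure \<rho>) UNIV \<le> ennreal C"
    unfolding emeasure_pos_measure[OF \<rho> space_in_borel]
    by (intro SUP_least ennreal_leI) (use C in force)
  then show "emeasure (pos_measure \<rho>) (space (pos_measure \<rho>)) \<noteq> \<infinity>"
    using ennreal_less_top[of C] by (auto simp: top_unique)
qed

text \<open>Half of the Jordan decomposition: for B \<subseteq> A, \<rho> B exceeds \<rho> A by -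
  \<rho> (A - B), which is at most the negative part evaluated at \<open>A\<close>; then take the
  supremum over \<open>B\<close>. The other half is the same bound for - \<rho>.\<close>

lemma pos_measure_le:
  assumes \<rho>: "sigma_additive borel \<rho>" and A: "A \<in> sets borel"
  shows "measure (pos_measure \<rho>) A \<le> \<rho> A + measure (pos_measure (\<lambda>A. - \<rho> A)) A"
proof -
  have n: "sigma_additive borel (\<lambda>A. - \<rho> A)"
    using sigma_additive_bounded_linear[OF bounded_linear_minus[OF bounded_linear_ident] \<rho>] .
  interpret P: finite_measure "pos_measure \<rho>" by (rule finite_measure_pos_measure[OF \<rho>])
  interpret N: finite_measure "pos_measure (\<lambda>A. - \<rho> A)" by (rule finite_measure_pos_measure[OF n])
  have low: "- \<rho> B \<le> measure (pos_measure (\<lambda>A. - \<rho> A)) A" if "B \<in> sets borel" "B \<subseteq> A" for B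
  proof -
    have "ennreal (- \<rho> B) \<le> emeasure (pos_measure (\<lambda>A. - \<rho> A)) A"
      unfolding emeasure_pos_measure[OF n A] by (rule SUP_upper) (use that in auto)
    then show ?thesis
      by (simp add: N.emeasure_eq_measure ennreal_le_iff)
  qed
  have nonneg: "0 \<le> \<rho> A + measure (pos_measure (\<lambda>A. - \<rho> A)) A"
    using low[OF A] by simp
  have "emeasure (pos_measure \<rho>) A \<le> ennreal (\<rho> A + measure (pos_measure (\<lambda>A. - \<rho> A)) A)"
    unfolding emeasure_pos_measure[OF \<rho> A]
  proof (intro SUP_least ennreal_leI)
    fix B assume "B \<in> {B \<in> sets borel. B \<subseteq> A}"
    then have B: "B \<in> sets borel" "B \<subseteq> A" by auto
    have "- \<rho> (A - B) \<le> measure (pos_measure (\<lambda>A. - \<rho> A)) A"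
      by (rule low) (use A B in auto)
    then show "\<rho> B \<le> \<rho> A + measure (pos_measure (\<lambda>A. - \<rho> A)) A"
      using sigma_additive_Diff[OF \<rho> A B] by simp
  qed
  then show ?thesis
    using nonneg by (simp add: P.emeasure_eq_measure ennreal_le_iff)
qed

lemma jordan_decomposition:
  assumes \<rho>: "sigma_additive borel \<rho>" and A: "A \<in> sets borel"
  shows "\<rho> A = measure (pos_measure \<rho>) A - measure (pos_measure (\<lambda>A. - \<rho> A)) A"
proof -
  have n: "sigma_additive borel (\<lambda>A. - \<rho> A)"
    using sigma_additive_bounded_linear[OF bounded_linear_minus[OF bounded_linear_ident] \<rho>] .
  show ?thesis
    using pos_measure_le[OF \<rho> A] pos_measure_le[OF n A] by simp
qed

section \<open>Radon-Nikodym derivatives\<close>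

text \<open>
  The measure \<open>M\<close> need not be sigma-finite, but by the last assumption \<open>\<rho>\<close> lives on a
  set where it is.
\<close>

lemma real_Radon_Nikodym:
  fixes \<rho> :: "'a::topological_space set \<Rightarrow> real"
  assumes \<rho>: "sigma_additive borel \<rho>" and M: "sets M = sets borel"
    and ac: "\<And>A. A \<in> null_sets M \<Longrightarrow> \<rho> A = 0"
    and K: "\<And>n::nat. K n \<in> sets borel" "\<And>n. emeasure M (K n) < \<infinity>"
    and conc: "\<And>A. A \<in> sets borel \<Longrightarrow> A \<inter> (\<Union>n. K n) = {} \<Longrightarrow> \<rho> A = 0"
  obtains r where "integrable M r" "\<And>A. A \<in> sets borel \<Longrightarrow> \<rho> A = (LINT z:A|M. r z)"
proof -
  define S where "S = (\<Union>n. K n)"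
  have S[measurable]: "S \<in> sets M" using K(1) M by (auto simp: S_def)
  \<comment> \<open>\<open>D\<close> is \<open>M\<close> restricted to \<open>S\<close>. It is
    sigma-finite because the \<open>K n\<close> cover \<open>S\<close> and the complement of
    \<open>S\<close> has \<open>D\<close>-measure 0.\<close>
  define D where "D = density M (indicator S)"
  have sD: "sets D = sets borel" and spD: "space D = UNIV"
    using M sets_eq_imp_space_eq[OF M] by (auto simp: D_def)
  have eD: "emeasure D A = emeasure M (S \<inter> A)" if "A \<in> sets borel" for A
    unfolding D_def using that M by (subst emeasure_density) (auto simp flip: indicator_inter_arith)
  interpret D: sigma_finite_measure D
  proof
    show "\<exists>A. countable A \<and> A \<subseteq> sets D \<and> \<Union> A = space D \<and> (\<forall>a\<in>A. emeasure D a \<noteq> \<infinity>)"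
    proof (intro exI conjI)
      show "countable (insert (- S) (range K))" by simp
      show "insert (- S) (range K) \<subseteq> sets D" using S K M by (auto simp: sD)
      show "\<Union> (insert (- S) (range K)) = space D" by (auto simp: spD S_def)
      show "\<forall>a\<in>insert (- S) (range K). emeasure D a \<noteq> \<infinity>"
      proof
        fix a assume "a \<in> insert (- S) (range K)"
        then consider "a = - S" | n where "a = K n" by auto
        then show "emeasure D a \<noteq> \<infinity>"
        proof cases
          case 1
          then show ?thesis using S M by (simp add: eD)
        next
          case 2
          then have "S \<inter> a = K n" by (auto simp: S_def)
          then show ?thesis using 2 K[of n] by (simp add: eD)
        qed
      qed
    qed
  qed
  \<comment> \<open>Stated for a general \<sigma> so as to serve both \<rho> and - \<rho>; the
    condition on zeros hands over both the vanishing on null sets and the concentration on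
    \<open>S\<close>.\<close>
  have ex: "\<exists>r. integrable M r \<and> (\<forall>A\<in>sets borel. measure (pos_measure \<sigma>) A = (LINT z:A|M. r z))"
    if \<sigma>: "sigma_additive borel \<sigma>" and \<sigma>0: "\<And>A. \<rho> A = 0 \<Longrightarrow> \<sigma> A = 0" for \<sigma> :: "'a set \<Rightarrow> real"
  proof -
    interpret P: finite_measure "pos_measure \<sigma>" by (rule finite_measure_pos_measure[OF \<sigma>])
    have "absolutely_continuous D (pos_measure \<sigma>)"
      unfolding absolutely_continuous_def
    proof
      fix A assume A: "A \<in> null_sets D"
      then have AB: "A \<in> sets borel" using sD by auto
      have "S \<inter> A \<in> null_sets M"
        using A eD[OF AB] AB S M by (auto simp: null_sets_def)
      \<comment> \<open>The positive part of \<open>A\<close> is a supremum over Borel subsets, so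
        each of them has to vanish: inside \<open>S\<close> it is null for \<open>M\<close>, outside
        \<open>S\<close> the concentration applies.\<close>
      have z: "\<sigma> B = 0" if B: "B \<in> sets borel" "B \<subseteq> A" for B
      proof -
        have "\<sigma> (B \<inter> S \<union> (B - S)) = \<sigma> (B \<inter> S) + \<sigma> (B - S)"
          by (rule sigma_additive_Un[OF \<sigma>]) (use B S M in auto)
        moreover have "B \<inter> S \<in> null_sets M"
          by (rule null_sets_subset[OF \<open>S \<inter> A \<in> null_sets M\<close>]) (use B S M in auto)
        then have "\<sigma> (B \<inter> S) = 0" by (intro \<sigma>0 ac)
        moreover have "\<sigma> (B - S) = 0"
          by (intro \<sigma>0 conc) (use B S M in \<open>auto simp: S_def\<close>)
        ultimately show ?thesis by (simp add: Int_Diff_Un)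
      qed
      have "emeasure (pos_measure \<sigma>) A = 0"
        unfolding emeasure_pos_measure[OF \<sigma> AB] using z
        by (intro antisym SUP_least) auto
      then show "A \<in> null_sets (pos_measure \<sigma>)" using AB by auto
    qed
    from D.Radon_Nikodym[OF this] obtain q where q: "q \<in> borel_measurable D"
      "density D q = pos_measure \<sigma>" by (auto simp: sD)
    have qM[measurable]: "q \<in> borel_measurable M" using q(1) by (simp add: D_def)
    have P: "pos_measure \<sigma> = density M (\<lambda>z. indicator S z * q z)"
      unfolding q(2)[symmetric] D_def by (rule density_density_eq) auto
    let ?q = "\<lambda>z. indicator S z * q z"
    \<comment> \<open>The derivative takes extended values. Its integral is the finite mass of the
      positive part, so it is finite almost everywhere and has an integrable real version.\<close>
    have fin: "(\<integral>\<^sup>+ z. ?q z \<partial>M) \<noteq> \<infinity>"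
      using P.emeasure_finite[of UNIV] sets_eq_imp_space_eq[OF M] M unfolding P
      by (subst (asm) emeasure_density) auto
    have "AE z in M. ?q z \<noteq> \<infinity>"
      by (rule nn_integral_PInf_AE) (use fin in auto)
    then have eq: "AE z in M. ?q z = ennreal (enn2real (?q z))"
      by (auto simp: less_top)
    have int: "integrable M (\<lambda>z. enn2real (?q z))"
      by (rule integrableI_nonneg)
         (use fin nn_integral_cong_AE[OF eq] in \<open>auto simp: less_top\<close>)
    have "measure (pos_measure \<sigma>) A = (LINT z:A|M. enn2real (?q z))" if A: "A \<in> sets borel" for A
    proof -
      have AM[measurable]: "A \<in> sets M" using A M by simp
      have "emeasure (pos_measure \<sigma>) A = (\<integral>\<^sup>+ z. ?q z * indicator A z \<partial>M)"
        unfolding P by (rule emeasure_density) auto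
      also have "\<dots> = (\<integral>\<^sup>+ z. ennreal (indicator A z *\<^sub>R enn2real (?q z)) \<partial>M)"
        by (rule nn_integral_cong_AE) (use eq in \<open>auto simp: indicator_def\<close>)
      also have "\<dots> = ennreal (LINT z:A|M. enn2real (?q z))"
        unfolding set_lebesgue_integral_def
        by (intro nn_integral_eq_integral integrable_mult_indicator AM int) auto
      finally show ?thesis
        unfolding P.emeasure_eq_measure
        by (subst (asm) ennreal_inj) (auto simp: set_lebesgue_integral_def)
    qed
    with int show ?thesis by blast
  qed
  have n: "sigma_additive borel (\<lambda>A. - \<rho> A)"
    using sigma_additive_bounded_linear[OF bounded_linear_minus[OF bounded_linear_ident] \<rho>] .
  obtain u where u: "integrable M u"
    "\<And>A. A \<in> sets borel \<Longrightarrow> measure (pos_measure \<rho>) A = (LINT z:A|M. u z)"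
    using ex[OF \<rho>] by auto
  obtain v where v: "integrable M v"
    "\<And>A. A \<in> sets borel \<Longrightarrow> measure (pos_measure (\<lambda>A. - \<rho> A)) A = (LINT z:A|M. v z)"
    using ex[OF n] by auto
  show thesis
  proof
    show "integrable M (\<lambda>z. u z - v z)" using u v by simp
    fix A :: "'a set" assume A: "A \<in> sets borel"
    have "set_integrable M A u" "set_integrable M A v"
      unfolding set_integrable_def
      by (intro integrable_mult_indicator u(1) v(1); use A M in simp)+
    then show "\<rho> A = (LINT z:A|M. u z - v z)"
      using jordan_decomposition[OF \<rho> A] u(2)[OF A] v(2)[OF A] by (simp add: set_integral_diff)
  qed
qed

text \<open>Exhibiting one density yields both properties of the chosen one. It is assembled from
  densities of the real and imaginary parts, which inherit the vanishing and concentration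
  hypotheses.\<close>

lemma complex_RN_deriv:
  fixes \<mu> :: "'a::topological_space set \<Rightarrow> complex"
  assumes \<mu>: "sigma_additive borel \<mu>" and M: "sets M = sets borel"
    and ac: "\<And>A. A \<in> null_sets M \<Longrightarrow> \<mu> A = 0"
    and K: "\<And>n::nat. K n \<in> sets borel" "\<And>n. emeasure M (K n) < \<infinity>"
    and conc: "\<And>A. A \<in> sets borel \<Longrightarrow> A \<inter> (\<Union>n. K n) = {} \<Longrightarrow> \<mu> A = 0"
  shows "integrable M (complex_RN_deriv M \<mu>)"
    and "A \<in> sets borel \<Longrightarrow> \<mu> A = (LINT z:A|M. complex_RN_deriv M \<mu> z)"
proof -
  obtain u where u: "integrable M u" "\<And>A. A \<in> sets borel \<Longrightarrow> Re (\<mu> A) = (LINT z:A|M. u z)"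
  proof (rule real_Radon_Nikodym[OF sigma_additive_bounded_linear[OF bounded_linear_Re \<mu>] M _ K])
    fix r
    assume "integrable M r" "\<And>A. A \<in> sets borel \<Longrightarrow> Re (\<mu> A) = (LINT z:A|M. r z)"
    then show thesis by (rule that)
  next
    show "Re (\<mu> A) = 0" if "A \<in> null_sets M" for A using ac[OF that] by simp
    show "Re (\<mu> A) = 0" if "A \<in> sets borel" "A \<inter> (\<Union>n. K n) = {}" for A
      using conc[OF that] by simp
  qed
  obtain v where v: "integrable M v" "\<And>A. A \<in> sets borel \<Longrightarrow> Im (\<mu> A) = (LINT z:A|M. v z)"
  proof (rule real_Radon_Nikodym[OF sigma_additive_bounded_linear[OF bounded_linear_Im \<mu>] M _ K])
    fix r
    assume "integrable M r" "\<And>A. A \<in> sets borel \<Longrightarrow> Im (\<mu> A) = (LINT z:A|M. r z)"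
    then show thesis by (rule that)
  next
    show "Im (\<mu> A) = 0" if "A \<in> null_sets M" for A using ac[OF that] by simp
    show "Im (\<mu> A) = 0" if "A \<in> sets borel" "A \<inter> (\<Union>n. K n) = {}" for A
      using conc[OF that] by simp
  qed
  let ?h = "\<lambda>z. complex_of_real (u z) + \<i> * complex_of_real (v z)"
  have h: "integrable M ?h" using u(1) v(1) by simp
  have "\<mu> A = (LINT z:A|M. ?h z)" if A: "A \<in> sets M" for A
  proof -
    have AB: "A \<in> sets borel" using A M by simp
    have si: "set_integrable M A (\<lambda>z. complex_of_real (u z))"
      "set_integrable M A (\<lambda>z. \<i> * complex_of_real (v z))"
      unfolding set_integrable_def by (intro integrable_mult_indicator A; simp add: u v)+
    have "(LINT z:A|M. ?h z)
        = (LINT z:A|M. complex_of_real (u z)) + \<i> * (LINT z:A|M. complex_of_real (v z))"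
      using set_integral_add(2)[OF si] by simp
    also have "\<dots> = complex_of_real (Re (\<mu> A)) + \<i> * complex_of_real (Im (\<mu> A))"
      by (simp only: u(2)[OF AB] v(2)[OF AB] set_integral_complex_of_real)
    finally show ?thesis by (simp only: complex_eq[symmetric])
  qed
  with h have "\<exists>h. integrable M h \<and> (\<forall>A\<in>sets M. \<mu> A = (LINT z:A|M. h z))" by blast
  then have "integrable M (complex_RN_deriv M \<mu>) \<and>
      (\<forall>A\<in>sets M. \<mu> A = (LINT z:A|M. complex_RN_deriv M \<mu> z))"
    unfolding complex_RN_deriv_def by (rule someI_ex)
  then show "integrable M (complex_RN_deriv M \<mu>)"
    and "A \<in> sets borel \<Longrightarrow> \<mu> A = (LINT z:A|M. complex_RN_deriv M \<mu> z)"
    using M by auto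
qed

section \<open>Set functions with a density\<close>

text \<open>\<open>measure_of\<close> depends only on the values on the sigma-algebra, so countable
  additivity of \<tau> is borrowed from the density and needs no separate proof.\<close>

lemma measure_of_eq_density:
  assumes M: "sets M = sets borel"
    and eq: "\<And>A. A \<in> sets borel \<Longrightarrow> \<tau> A = emeasure (density M f) A"
  shows "measure_of UNIV (sets borel) \<tau> = density M f"
proof -
  have "measure_of UNIV (sets borel) \<tau> = measure_of UNIV (sets borel) (emeasure (density M f))"
    by (rule measure_of_eq) (use eq sets.sigma_sets_eq[of borel] in auto)
  also have "\<dots> = density M f"
    using measure_of_of_measure[of "density M f"] sets_eq_imp_space_eq[OF M] M by simp
  finally show ?thesis .
qed

text \<open>The supremum over subsets of \<open>A\<close> is attained at the part of
  \<open>A\<close> where \<open>r\<close> is non-negative; \<open>ennreal (r z)\<close> is already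
  the positive part of \<open>r\<close>.\<close>

lemma pos_measure_eq_density:
  fixes r :: "'a::topological_space \<Rightarrow> real"
  assumes M: "sets M = sets borel" and r: "integrable M r"
    and \<rho>: "\<And>A. A \<in> sets borel \<Longrightarrow> \<rho> A = (LINT z:A|M. r z)"
  shows "pos_measure \<rho> = density M (\<lambda>z. ennreal (r z))"
  unfolding pos_measure_def
proof (rule measure_of_eq_density[OF M])
  fix A :: "'a set" assume A: "A \<in> sets borel"
  have rM[measurable]: "r \<in> borel_measurable M" using r by simp
  have AM[measurable]: "A \<in> sets M" using A M by simp
  have em: "emeasure (density M (\<lambda>z. ennreal (r z))) B = ennreal (LINT z:B|M. max 0 (r z))"
    if B: "B \<in> sets M" for B
  proof -
    have "emeasure (density M (\<lambda>z. ennreal (r z))) B = (\<integral>\<^sup>+ z. ennreal (r z) * indicator B z \<partial>M)"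
      using B by (simp add: emeasure_density)
    also have "\<dots> = (\<integral>\<^sup>+ z. ennreal (indicator B z *\<^sub>R max 0 (r z)) \<partial>M)"
      by (intro nn_integral_cong) (auto simp: indicator_def ennreal_max_0)
    also have "\<dots> = ennreal (LINT z:B|M. max 0 (r z))"
      unfolding set_lebesgue_integral_def
      by (intro nn_integral_eq_integral integrable_mult_indicator B) (use r in auto)
    finally show ?thesis .
  qed
  show "(SUP B\<in>{B \<in> sets borel. B \<subseteq> A}. ennreal (\<rho> B)) = emeasure (density M (\<lambda>z. ennreal (r z))) A"
  proof (rule antisym)
    show "(SUP B\<in>{B \<in> sets borel. B \<subseteq> A}. ennreal (\<rho> B))
        \<le> emeasure (density M (\<lambda>z. ennreal (r z))) A"
    proof (rule SUP_least)
      fix B assume "B \<in> {B \<in> sets borel. B \<subseteq> A}"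
      then have B: "B \<in> sets borel" "B \<subseteq> A" by auto
      have BM: "B \<in> sets M" using B M by simp
      have "\<rho> B \<le> (LINT z:B|M. max 0 (r z))"
        unfolding \<rho>[OF B(1)] set_lebesgue_integral_def
        by (intro integral_mono integrable_mult_indicator BM) (use r in \<open>auto simp: indicator_def\<close>)
      then have "ennreal (\<rho> B) \<le> emeasure (density M (\<lambda>z. ennreal (r z))) B"
        unfolding em[OF BM] by (rule ennreal_leI)
      also have "\<dots> \<le> emeasure (density M (\<lambda>z. ennreal (r z))) A"
        by (intro emeasure_mono) (use B in auto)
      finally show "ennreal (\<rho> B) \<le> emeasure (density M (\<lambda>z. ennreal (r z))) A" .
    qed
    define B where "B = A \<inter> {z \<in> space M. 0 \<le> r z}"
    have BM: "B \<in> sets M" unfolding B_def by measurable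
    have "(LINT z:A|M. max 0 (r z)) = (LINT z:B|M. r z)"
      unfolding set_lebesgue_integral_def
      by (rule Bochner_Integration.integral_cong) (auto simp: B_def indicator_def max_def)
    then have eq: "emeasure (density M (\<lambda>z. ennreal (r z))) A = ennreal (\<rho> B)"
      using em[OF AM] \<rho>[of B] BM M by simp
    have "B \<in> {B \<in> sets borel. B \<subseteq> A}" using BM M by (auto simp: B_def)
    then show "emeasure (density M (\<lambda>z. ennreal (r z))) A
        \<le> (SUP B\<in>{B \<in> sets borel. B \<subseteq> A}. ennreal (\<rho> B))"
      unfolding eq by (rule SUP_upper)
  qed
qed

text \<open>The Jordan parts have densities \<open>max 0 (r z)\<close> and
  \<open>max 0 (- r z)\<close>, whose difference is \<open>r z\<close>. Both are dominated by the
  absolute value of \<open>r\<close>, so each integral converges and the two may be merged.\<close>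

lemma signed_integral_eq_density:
  fixes r :: "'a::topological_space \<Rightarrow> real" and F :: "'a \<Rightarrow> complex"
  assumes M: "sets M = sets borel" and r: "integrable M r"
    and \<rho>: "\<And>A. A \<in> sets borel \<Longrightarrow> \<rho> A = (LINT z:A|M. r z)"
    and F: "F \<in> borel_measurable borel" and rF: "integrable M (\<lambda>z. r z *\<^sub>R F z)"
  shows "signed_integral \<rho> F = (LINT z|M. r z *\<^sub>R F z)"
proof -
  have [measurable]: "r \<in> borel_measurable M" using r by simp
  have FM[measurable]: "F \<in> borel_measurable M" using F measurable_cong_sets[OF M refl] by auto
  have bound: "integrable M (\<lambda>z. s z *\<^sub>R F z)"
    if "s \<in> borel_measurable M" "\<And>z. \<bar>s z\<bar> \<le> \<bar>r z\<bar>" for s :: "'a \<Rightarrow> real"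
    by (rule Bochner_Integration.integrable_bound[OF rF])
       (use that in \<open>auto intro!: mult_right_mono\<close>)
  have dens: "(LINT z|density M (\<lambda>z. ennreal (s z)). F z) = (LINT z|M. max 0 (s z) *\<^sub>R F z)"
    if [measurable]: "s \<in> borel_measurable M" for s :: "'a \<Rightarrow> real"
    using integral_density[OF FM, of "\<lambda>z. max 0 (s z)"] by (simp add: ennreal_max_0)
  have pos: "pos_measure \<rho> = density M (\<lambda>z. ennreal (r z))"
    by (rule pos_measure_eq_density[OF M r \<rho>])
  have neg: "pos_measure (\<lambda>A. - \<rho> A) = density M (\<lambda>z. ennreal (- r z))"
    by (rule pos_measure_eq_density[OF M]) (use r \<rho> in \<open>auto simp: set_lebesgue_integral_def\<close>)
  have "signed_integral \<rho> F
      = (LINT z|M. max 0 (r z) *\<^sub>R F z) - (LINT z|M. max 0 (- r z) *\<^sub>R F z)"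
    unfolding signed_integral_def pos neg by (simp add: dens)
  also have "\<dots> = (LINT z|M. max 0 (r z) *\<^sub>R F z - max 0 (- r z) *\<^sub>R F z)"
    by (intro Bochner_Integration.integral_diff[symmetric] bound) auto
  also have "\<dots> = (LINT z|M. r z *\<^sub>R F z)"
    by (intro Bochner_Integration.integral_cong) (auto simp: max_def)
  finally show ?thesis .
qed

text \<open>Only \<open>h\<close> is split into real and imaginary parts; \<open>F\<close> stays
  complex. Integrability of the two products follows from that of \<open>h z * F z\<close>, since
  both parts are bounded by the modulus of \<open>h\<close>.\<close>

lemma complex_measure_integral_eq_density:
  fixes h F :: "'a::topological_space \<Rightarrow> complex"
  assumes M: "sets M = sets borel" and h: "integrable M h"
    and \<mu>: "\<And>A. A \<in> sets borel \<Longrightarrow> \<mu> A = (LINT z:A|M. h z)"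
    and F: "F \<in> borel_measurable borel" and hF: "integrable M (\<lambda>z. h z * F z)"
  shows "complex_measure_integral \<mu> F = (LINT z|M. h z * F z)"
proof -
  have hM[measurable]: "h \<in> borel_measurable M" using h by simp
  have FM[measurable]: "F \<in> borel_measurable M" using F measurable_cong_sets[OF M refl] by auto
  have si: "integrable M (\<lambda>z. indicator A z *\<^sub>R h z)" if "A \<in> sets borel" for A
    using that M h by (auto intro!: integrable_mult_indicator)
  have "Re (\<mu> A) = (LINT z:A|M. Re (h z))" if "A \<in> sets borel" for A
    using integral_Re[OF si[OF that]] \<mu>[OF that] by (simp add: set_lebesgue_integral_def)
  moreover have reF: "integrable M (\<lambda>z. Re (h z) *\<^sub>R F z)"
    by (rule Bochner_Integration.integrable_bound[OF hF])
       (auto simp: norm_mult intro!: mult_right_mono abs_Re_le_cmod)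
  ultimately have re: "signed_integral (\<lambda>A. Re (\<mu> A)) F = (LINT z|M. Re (h z) *\<^sub>R F z)"
    by (intro signed_integral_eq_density[OF M _ _ F]) (use h in auto)
  have "Im (\<mu> A) = (LINT z:A|M. Im (h z))" if "A \<in> sets borel" for A
    using integral_Im[OF si[OF that]] \<mu>[OF that] by (simp add: set_lebesgue_integral_def)
  moreover have imF: "integrable M (\<lambda>z. Im (h z) *\<^sub>R F z)"
    by (rule Bochner_Integration.integrable_bound[OF hF])
       (auto simp: norm_mult intro!: mult_right_mono abs_Im_le_cmod)
  ultimately have im: "signed_integral (\<lambda>A. Im (\<mu> A)) F = (LINT z|M. Im (h z) *\<^sub>R F z)"
    by (intro signed_integral_eq_density[OF M _ _ F]) (use h in auto)
  have "complex_measure_integral \<mu> F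
      = (LINT z|M. Re (h z) *\<^sub>R F z) + (LINT z|M. \<i> * (Im (h z) *\<^sub>R F z))"
    unfolding complex_measure_integral_def re im by (simp only: integral_mult_right_zero)
  also have "\<dots> = (LINT z|M. Re (h z) *\<^sub>R F z + \<i> * (Im (h z) *\<^sub>R F z))"
    by (intro Bochner_Integration.integral_add[symmetric] integrable_mult_right reF imF)
  also have "\<dots> = (LINT z|M. h z * F z)"
  proof (intro Bochner_Integration.integral_cong refl)
    fix z
    have "(complex_of_real (Re (h z)) + \<i> * complex_of_real (Im (h z))) * F z = h z * F z"
      by (simp only: complex_eq[symmetric])
    then show "Re (h z) *\<^sub>R F z + \<i> * (Im (h z) *\<^sub>R F z) = h z * F z"
      by (simp add: scaleR_conv_of_real algebra_simps)
  qed
  finally show ?thesis .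
qed

section \<open>Total variation of a complex set function with an integrable density\<close>

lemma sum_le_variation:
  assumes I: "finite I" "disjoint_family_on B I" "\<And>i. i \<in> I \<Longrightarrow> B i \<in> sets borel"
    and \<mu>: "\<mu> {} = 0"
  shows "(\<Sum>i\<in>I. ennreal (cmod (\<mu> (B i)))) \<le> variation \<mu> (\<Union>i\<in>I. B i)"
proof -
  \<comment> \<open>\<open>partition_on\<close> admits no empty block. Non-empty disjoint blocks are
    distinct, so \<open>B\<close> is injective on \<open>J\<close>, and the dropped terms are
    0.\<close>
  define J where "J = {i \<in> I. B i \<noteq> {}}"
  have dis: "B i \<inter> B j = {}" if "i \<in> J" "j \<in> J" "i \<noteq> j" for i j
    using that I(2) by (auto simp: J_def disjoint_family_on_def)
  have inj: "inj_on B J"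
    by (rule inj_onI) (use dis J_def in blast)
  have "partition_on (\<Union>i\<in>I. B i) (B ` J)"
    unfolding partition_on_def disjoint_def using dis by (auto simp: J_def)
  then have "(\<Sum>C\<in>B ` J. ennreal (cmod (\<mu> C))) \<le> variation \<mu> (\<Union>i\<in>I. B i)"
    unfolding variation_def by (intro SUP_upper) (use I in \<open>auto simp: J_def\<close>)
  also have "(\<Sum>C\<in>B ` J. ennreal (cmod (\<mu> C))) = (\<Sum>i\<in>J. ennreal (cmod (\<mu> (B i))))"
    by (simp add: sum.reindex[OF inj])
  also have "\<dots> = (\<Sum>i\<in>I. ennreal (cmod (\<mu> (B i))))"
    by (rule sum.mono_neutral_left) (use I \<mu> in \<open>auto simp: J_def\<close>)
  finally show ?thesis .
qed

text \<open>\<open>A\<close> is cut into \<open>B\<close> and \<open>A - B\<close>, indexed by the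
  booleans; either block may be empty.\<close>

lemma cmod_le_variation:
  assumes "\<mu> {} = 0" "A \<in> sets borel" "B \<in> sets borel" "B \<subseteq> A"
  shows "ennreal (cmod (\<mu> B)) \<le> variation \<mu> A"
proof -
  let ?B = "\<lambda>b. if b then B else A - B"
  have "ennreal (cmod (\<mu> B)) \<le> (\<Sum>b\<in>UNIV. ennreal (cmod (\<mu> (?B b))))"
    by (simp add: UNIV_bool)
  also have "\<dots> \<le> variation \<mu> (\<Union>b\<in>UNIV. ?B b)"
    by (rule sum_le_variation) (use assms in \<open>auto simp: disjoint_family_on_def\<close>)
  also have "(\<Union>b\<in>UNIV. ?B b) = A" using assms by (auto simp: UNIV_bool)
  finally show ?thesis .
qed

text \<open>
  The partition into the level sets of a simple function close to \<open>h\<close> in \<open>L\<^sup>1\<close> almost attains the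
  variation.
\<close>

lemma cmod_integral_le_variation:
  fixes h :: "'a::topological_space \<Rightarrow> complex"
  assumes M: "sets M = sets borel" and h: "integrable M h"
    and \<mu>: "\<And>A. A \<in> sets borel \<Longrightarrow> \<mu> A = (LINT z:A|M. h z)"
    and A: "A \<in> sets borel"
  shows "ennreal (LINT z:A|M. cmod (h z)) \<le> variation \<mu> A"
proof (rule ennreal_le_epsilon)
  fix e :: real assume e: "0 < e"
  have [measurable]: "h \<in> borel_measurable M" using h by simp
  have spM: "space M = UNIV" using sets_eq_imp_space_eq[OF M] by simp
  \<comment> \<open>The approximating simple functions are read off from the definition of the
    Bochner integral.\<close>
  obtain x where "has_bochner_integral M h x" using h by (auto simp: integrable.simps)
  then obtain s where s: "\<And>i. Bochner_Integration.simple_bochner_integrable M (s i)"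
    and lim: "(\<lambda>i. \<integral>\<^sup>+z. norm (h z - s i z) \<partial>M) \<longlonglongrightarrow> 0"
    by (auto simp: has_bochner_integral.simps)
  have "\<forall>\<^sub>F i in sequentially. (\<integral>\<^sup>+z. norm (h z - s i z) \<partial>M) < ennreal (e/2)"
    using order_tendstoD(2)[OF lim, of "ennreal (e/2)"] e by simp
  then obtain i where i: "(\<integral>\<^sup>+z. norm (h z - s i z) \<partial>M) < ennreal (e/2)"
    using eventually_happens'[OF sequentially_bot] by blast
  define t where "t = s i"
  have "simple_function M t" using s[of i] by (simp add: t_def Bochner_Integration.simple_bochner_integrable.simps)
  then have tM[measurable]: "t \<in> borel_measurable M" and fin: "finite (range t)"
    using simple_functionD(1)[of M t] spM by (auto intro: borel_measurable_simple_function)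
  have small: "(\<integral>\<^sup>+z. norm (h z - t z) \<partial>M) < ennreal (e/2)" using i by (simp add: t_def)
  then have ht: "integrable M (\<lambda>z. h z - t z)"
    by (intro integrableI_bounded) (auto intro: less_trans)
  \<comment> \<open>Half of \<open>e\<close>, because the approximation error enters
    \<open>piece\<close> with the factor 2.\<close>
  have hte: "(LINT z|M. cmod (h z - t z)) < e/2"
    using small nn_integral_eq_integral[OF integrable_norm[OF ht]] e
    by (simp add: ennreal_less_iff)
  \<comment> \<open>A value taken by \<open>t\<close> only outside \<open>A\<close> gives an empty
    block, which \<open>sum_le_variation\<close> allows.\<close>
  define B where "B c = A \<inter> t -` {c}" for c
  have BM: "B c \<in> sets M" for c
    using measurable_sets[OF tM, of "{c}"] A M spM by (auto simp: B_def)
  have UB: "(\<Union>c\<in>range t. B c) = A" by (auto simp: B_def)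
  have dB: "disjoint_family_on B (range t)" by (auto simp: B_def disjoint_family_on_def)
  have si: "integrable M (\<lambda>z. indicator (B c) z *\<^sub>R f z)" if "integrable M f"
    for c and f :: "'a \<Rightarrow> 'b::{banach, second_countable_topology}"
    by (rule integrable_mult_indicator[OF BM that])
  have split: "(LINT z:A|M. f z) = (\<Sum>c\<in>range t. LINT z:B c|M. f z)" if "integrable M f"
    for f :: "'a \<Rightarrow> real"
    unfolding UB[symmetric]
    by (rule set_integral_finite_Union)
       (use fin dB BM si[OF that] in \<open>auto simp: set_integrable_def\<close>)
  have piece: "(LINT z:B c|M. cmod (h z)) \<le> cmod (\<mu> (B c)) + 2 * (LINT z:B c|M. cmod (h z - t z))" for c
  proof -
    \<comment> \<open>Multiplication by \<open>cnj (sgn c)\<close> rotates \<open>c\<close> onto its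
      modulus. Passing between \<open>w\<close> and \<open>c\<close> costs
      \<open>cmod (w - c)\<close> twice: once in the modulus, once in the rotated real part. The
      case c = 0 is included, as \<open>sgn 0 = 0\<close>.\<close>
    have pw: "cmod w \<le> Re (cnj (sgn c) * w) + 2 * cmod (w - c)" for w
    proof -
      have "cnj (sgn c) * c = (c * cnj c) / complex_of_real (cmod c)"
        by (simp add: sgn_eq mult.commute)
      also have "\<dots> = complex_of_real (cmod c)"
        by (simp only: complex_norm_square[symmetric]) (simp add: power2_eq_square)
      finally have "Re (cnj (sgn c) * c) = cmod c" by simp
      moreover have "cmod (cnj (sgn c) * (w - c)) \<le> cmod (w - c)"
        by (simp add: norm_mult norm_sgn)
      then have "- cmod (w - c) \<le> Re (cnj (sgn c) * (w - c))"
        using abs_Re_le_cmod[of "cnj (sgn c) * (w - c)"] by linarith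
      moreover have "Re (cnj (sgn c) * w) = Re (cnj (sgn c) * c) + Re (cnj (sgn c) * (w - c))"
        by (simp add: algebra_simps)
      moreover have "cmod w \<le> cmod c + cmod (w - c)" by norm
      ultimately show ?thesis by linarith
    qed
    have i1: "integrable M (\<lambda>z. indicator (B c) z *\<^sub>R Re (cnj (sgn c) * h z))"
      by (rule si) (use h in auto)
    have i2: "integrable M (\<lambda>z. indicator (B c) z *\<^sub>R cmod (h z - t z))"
      by (rule si) (use ht in auto)
    have "(LINT z:B c|M. cmod (h z))
        \<le> (LINT z|M. indicator (B c) z *\<^sub>R Re (cnj (sgn c) * h z)
            + 2 * (indicator (B c) z *\<^sub>R cmod (h z - t z)))"
      unfolding set_lebesgue_integral_def
    proof (rule integral_mono)
      show "integrable M (\<lambda>z. indicator (B c) z *\<^sub>R cmod (h z))"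
        by (rule si) (use h in auto)
      show "integrable M (\<lambda>z. indicator (B c) z *\<^sub>R Re (cnj (sgn c) * h z)
            + 2 * (indicator (B c) z *\<^sub>R cmod (h z - t z)))"
        using i1 i2 by auto
      show "indicator (B c) z *\<^sub>R cmod (h z) \<le> indicator (B c) z *\<^sub>R Re (cnj (sgn c) * h z)
            + 2 * (indicator (B c) z *\<^sub>R cmod (h z - t z))" for z
        using pw[of "h z"] by (auto simp: indicator_def B_def)
    qed
    also have "\<dots> = (LINT z:B c|M. Re (cnj (sgn c) * h z)) + 2 * (LINT z:B c|M. cmod (h z - t z))"
      using i1 i2 by (simp add: set_lebesgue_integral_def)
    also have "(LINT z:B c|M. Re (cnj (sgn c) * h z)) = Re (cnj (sgn c) * \<mu> (B c))"
    proof -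
      have "(LINT z:B c|M. Re (cnj (sgn c) * h z))
          = (LINT z|M. Re (cnj (sgn c) * (indicator (B c) z *\<^sub>R h z)))"
        unfolding set_lebesgue_integral_def
        by (intro Bochner_Integration.integral_cong refl) (simp add: indicator_def)
      also have "\<dots> = Re (LINT z|M. cnj (sgn c) * (indicator (B c) z *\<^sub>R h z))"
        by (rule integral_Re) (intro integrable_mult_right si h)
      also have "(LINT z|M. cnj (sgn c) * (indicator (B c) z *\<^sub>R h z)) = cnj (sgn c) * \<mu> (B c)"
        using \<mu>[of "B c"] BM[of c] M by (simp only: integral_mult_right_zero set_lebesgue_integral_def)
      finally show ?thesis .
    qed
    also have "Re (cnj (sgn c) * \<mu> (B c)) \<le> cmod (\<mu> (B c))"
      by (rule order_trans[OF complex_Re_le_cmod]) (simp add: norm_mult norm_sgn)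
    finally show ?thesis by simp
  qed
  have "(LINT z:A|M. cmod (h z)) = (\<Sum>c\<in>range t. LINT z:B c|M. cmod (h z))"
    by (rule split) (use h in auto)
  also have "\<dots> \<le> (\<Sum>c\<in>range t. cmod (\<mu> (B c)) + 2 * (LINT z:B c|M. cmod (h z - t z)))"
    by (intro sum_mono piece)
  also have "\<dots> = (\<Sum>c\<in>range t. cmod (\<mu> (B c))) + 2 * (LINT z:A|M. cmod (h z - t z))"
    using split[OF integrable_norm[OF ht]] by (simp add: sum.distrib sum_distrib_left)
  also have "(LINT z:A|M. cmod (h z - t z)) \<le> (LINT z|M. cmod (h z - t z))"
    unfolding set_lebesgue_integral_def
    by (intro integral_mono integrable_mult_indicator) (use ht A M in \<open>auto simp: indicator_def\<close>)
  finally have "(LINT z:A|M. cmod (h z)) \<le> (\<Sum>c\<in>range t. cmod (\<mu> (B c))) + e"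
    using hte by simp
  then have "ennreal (LINT z:A|M. cmod (h z)) \<le> ennreal ((\<Sum>c\<in>range t. cmod (\<mu> (B c))) + e)"
    by (rule ennreal_leI)
  also have "\<dots> = (\<Sum>c\<in>range t. ennreal (cmod (\<mu> (B c)))) + ennreal e"
    using e by (simp add: sum_nonneg)
  also have "(\<Sum>c\<in>range t. ennreal (cmod (\<mu> (B c)))) \<le> variation \<mu> A"
    using sum_le_variation[OF fin dB, of \<mu>] BM M UB \<mu>[of "{}"]
    by (simp add: set_lebesgue_integral_def)
  finally show "ennreal (LINT z:A|M. cmod (h z)) \<le> variation \<mu> A + ennreal e"
    by (simp add: add_right_mono)
qed

text \<open>The upper bound is the triangle inequality for integrals on each block of a partition;
  the lower bound is the approximation by level sets.\<close>

lemma variation_eq_integral: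
  fixes h :: "'a::topological_space \<Rightarrow> complex"
  assumes M: "sets M = sets borel" and h: "integrable M h"
    and \<mu>: "\<And>A. A \<in> sets borel \<Longrightarrow> \<mu> A = (LINT z:A|M. h z)"
    and A: "A \<in> sets borel"
  shows "variation \<mu> A = ennreal (LINT z:A|M. cmod (h z))"
proof (rule antisym)
  show "variation \<mu> A \<le> ennreal (LINT z:A|M. cmod (h z))"
    unfolding variation_def
  proof (rule SUP_least)
    fix P assume "P \<in> {P. finite P \<and> P \<subseteq> sets borel \<and> partition_on A P}"
    then have P: "finite P" "P \<subseteq> sets borel" "disjoint P" "\<Union>P = A"
      by (auto simp: partition_on_def)
    have si: "set_integrable M B (\<lambda>z. cmod (h z))" if "B \<in> P" for B
      unfolding set_integrable_def
      by (rule integrable_mult_indicator) (use that P M h in auto)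
    have "(\<Sum>B\<in>P. ennreal (cmod (\<mu> B))) = ennreal (\<Sum>B\<in>P. cmod (\<mu> B))"
      by simp
    also have "\<dots> \<le> ennreal (\<Sum>B\<in>P. LINT z:B|M. cmod (h z))"
    proof (intro ennreal_leI sum_mono)
      fix B assume "B \<in> P"
      then have B: "B \<in> sets borel" using P by auto
      have "cmod (LINT z|M. indicator B z *\<^sub>R h z) \<le> (LINT z|M. cmod (indicator B z *\<^sub>R h z))"
        by (rule integral_norm_bound)
      then show "cmod (\<mu> B) \<le> (LINT z:B|M. cmod (h z))"
        unfolding \<mu>[OF B] set_lebesgue_integral_def by simp
    qed
    also have "(\<Sum>B\<in>P. LINT z:B|M. cmod (h z)) = (LINT z:(\<Union>B\<in>P. B)|M. cmod (h z))"
      by (rule set_integral_finite_Union[symmetric])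
         (use P M si in \<open>auto simp: disjoint_def disjoint_family_on_def\<close>)
    also have "(\<Union>B\<in>P. B) = A" using P by auto
    finally show "(\<Sum>B\<in>P. ennreal (cmod (\<mu> B))) \<le> ennreal (LINT z:A|M. cmod (h z))" .
  qed
qed (rule cmod_integral_le_variation[OF M h \<mu> A])

text \<open>This makes weak integrability usable, since \<open>L1_weak\<close> is phrased through
  variation measures.\<close>

lemma variation_measure_eq_density:
  fixes h :: "'a::topological_space \<Rightarrow> complex"
  assumes M: "sets M = sets borel" and h: "integrable M h"
    and \<mu>: "\<And>A. A \<in> sets borel \<Longrightarrow> \<mu> A = (LINT z:A|M. h z)"
  shows "variation_measure \<mu> = density M (\<lambda>z. ennreal (cmod (h z)))"
  unfolding variation_measure_def
proof (rule measure_of_eq_density[OF M])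
  fix A :: "'a set" assume A: "A \<in> sets borel"
  have AM: "A \<in> sets M" using A M by simp
  have "emeasure (density M (\<lambda>z. ennreal (cmod (h z)))) A
      = (\<integral>\<^sup>+ z. ennreal (cmod (h z)) * indicator A z \<partial>M)"
    by (rule emeasure_density) (use h AM in auto)
  also have "\<dots> = (\<integral>\<^sup>+ z. ennreal (indicator A z *\<^sub>R cmod (h z)) \<partial>M)"
    by (intro nn_integral_cong) (auto simp: indicator_def)
  also have "\<dots> = ennreal (LINT z:A|M. cmod (h z))"
    unfolding set_lebesgue_integral_def
    by (intro nn_integral_eq_integral integrable_mult_indicator AM) (use h in auto)
  finally show "variation \<mu> A = emeasure (density M (\<lambda>z. ennreal (cmod (h z)))) A"
    using variation_eq_integral[OF M h \<mu> A] by simp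
qed

section \<open>Vector measures\<close>

text \<open>\<open>semivariation\<close> and \<open>L1_weak\<close> take suprema over the unit ball
  of the dual only; rescaling makes them bear on an arbitrary functional.\<close>

lemma complex_dual_scale_unit_ball:
  assumes "\<phi> \<in> complex_dual"
  obtains c :: real where "0 < c" "(\<lambda>x. complex_of_real c * \<phi> x) \<in> complex_dual"
    "onorm (\<lambda>x. complex_of_real c * \<phi> x) \<le> 1"
proof
  have bl: "bounded_linear \<phi>" using assms by (simp add: complex_dual_def)
  have n0: "0 \<le> onorm \<phi>" by (rule onorm_pos_le[OF bl])
  \<comment> \<open>Adding 1 keeps the denominator positive when \<phi> is zero.\<close>
  let ?c = "1 / (onorm \<phi> + 1)"
  show "0 < ?c" using n0 by simp
  show "(\<lambda>x. complex_of_real ?c * \<phi> x) \<in> complex_dual"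
    using assms bounded_linear_const_mult[OF bl, of "complex_of_real ?c"]
    by (simp add: complex_dual_def del: of_real_divide)
  show "onorm (\<lambda>x. complex_of_real ?c * \<phi> x) \<le> 1"
  proof (rule onorm_bound)
    show "0 \<le> (1::real)" by simp
    fix x
    have "cmod (\<phi> x) \<le> onorm \<phi> * norm x" by (rule onorm[OF bl])
    also have "\<dots> \<le> (onorm \<phi> + 1) * norm x" by (intro mult_right_mono) auto
    finally show "cmod (complex_of_real ?c * \<phi> x) \<le> 1 * norm x"
      using n0 by (simp add: norm_mult norm_divide field_simps flip: of_real_add)
  qed
qed

lemma sigma_additive_dual:
  assumes "vector_measure \<nu>" "\<phi> \<in> complex_dual"
  shows "sigma_additive borel (\<lambda>A. \<phi> (\<nu> A))"
proof (rule sigma_additive_bounded_linear[of \<phi> borel \<nu>])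
  show "bounded_linear \<phi>" using assms(2) by (simp add: complex_dual_def)
  show "sigma_additive borel \<nu>"
    using assms(1) by (simp add: sigma_additive_def vector_measure_def)
qed

text \<open>
  Regularity of the vector measure at \<open>UNIV\<close> confines \<open>\<phi> \<circ> \<nu>\<close> to a \<open>\<sigma>\<close>-compact set, on which the
  Haar measure is \<open>\<sigma>\<close>-finite.
\<close>

lemma M_ac_RN_deriv:
  fixes m :: "'a::t2_space measure" and \<nu> :: "'a set \<Rightarrow> 'x::complex_normed_vector"
  assumes m: "sets m = sets borel" "\<And>K. compact K \<Longrightarrow> emeasure m K < \<infinity>"
    and \<nu>: "\<nu> \<in> M_ac m" and \<phi>: "\<phi> \<in> complex_dual"
  shows "integrable m (complex_RN_deriv m (\<lambda>A. \<phi> (\<nu> A)))"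
    and "A \<in> sets borel \<Longrightarrow> \<phi> (\<nu> A) = (LINT z:A|m. complex_RN_deriv m (\<lambda>A. \<phi> (\<nu> A)) z)"
proof -
  have vm: "vector_measure \<nu>" and reg: "regular_vector_measure \<nu>"
    and ac: "\<And>A. A \<in> null_sets m \<Longrightarrow> \<nu> A = 0"
    using \<nu> by (auto simp: M_ac_def)
  have \<phi>0: "\<phi> 0 = 0"
    using \<phi> by (simp add: complex_dual_def bounded_linear.linear linear_0)
  obtain c where c: "0 < c" "(\<lambda>x. complex_of_real c * \<phi> x) \<in> complex_dual"
    "onorm (\<lambda>x. complex_of_real c * \<phi> x) \<le> 1"
    using complex_dual_scale_unit_ball[OF \<phi>] by blast
  define \<mu> where "\<mu> A = complex_of_real c * \<phi> (\<nu> A)" for A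
  have \<mu>: "sigma_additive borel \<mu>"
    unfolding \<mu>_def using sigma_additive_dual[OF vm c(2)] .
  have "\<exists>K. compact K \<and> semivariation \<nu> (- K) < ennreal (1 / Suc n)" for n
  proof -
    \<comment> \<open>The open set can only be the whole space, so \<open>U - K\<close> is the
      complement of \<open>K\<close>.\<close>
    obtain K U where "compact K" "UNIV \<subseteq> U" "semivariation \<nu> (U - K) < ennreal (1 / Suc n)"
      using reg[unfolded regular_vector_measure_def, rule_format, of UNIV "1 / Suc n"]
      by auto
    then show ?thesis by (auto simp: Compl_eq_Diff_UNIV top.extremum_unique)
  qed
  then obtain K where K: "\<And>n. compact (K n)" "\<And>n. semivariation \<nu> (- K n) < ennreal (1 / Suc n)"
    by metis
  \<comment> \<open>In a Hausdorff space compact sets are closed, hence Borel.\<close>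
  have KB: "K n \<in> sets borel" for n using K(1) by (simp add: borel_compact)
  have conc: "\<phi> (\<nu> A) = 0" if A: "A \<in> sets borel" "A \<inter> (\<Union>n. K n) = {}" for A
  proof -
    \<comment> \<open>\<open>A\<close> lies in the complement of every \<open>K n\<close>. The
      rescaled \<mu> is used because its functional is in the unit ball, so the semivariation
      dominates its variation.\<close>
    have "cmod (\<mu> A) \<le> 1 / Suc n" for n
    proof -
      have "ennreal (cmod (\<mu> A)) \<le> variation \<mu> (- K n)"
        by (rule cmod_le_variation) (use sigma_additive_empty[OF \<mu>] A KB[of n] in auto)
      also have "\<dots> \<le> semivariation \<nu> (- K n)"
        unfolding semivariation_def \<mu>_def by (rule SUP_upper2[of "\<lambda>x. complex_of_real c * \<phi> x"]) (use c in auto)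
      also have "\<dots> \<le> ennreal (1 / Suc n)" using K(2) by (rule less_imp_le)
      finally show ?thesis by (subst (asm) ennreal_le_iff) auto
    qed
    moreover have "(\<lambda>n. 1 / real (Suc n)) \<longlonglongrightarrow> 0"
      by (rule LIMSEQ_Suc[OF lim_1_over_n])
    ultimately have "cmod (\<mu> A) \<le> 0"
      by (intro LIMSEQ_le_const) auto
    then show ?thesis using c(1) by (simp add: \<mu>_def)
  qed
  have ac': "\<phi> (\<nu> A) = 0" if "A \<in> null_sets m" for A
    using ac[OF that] \<phi>0 by simp
  note RN = complex_RN_deriv[OF sigma_additive_dual[OF vm \<phi>] m(1) ac' KB m(2)[OF K(1)] conc]
  show "integrable m (complex_RN_deriv m (\<lambda>A. \<phi> (\<nu> A)))"
    by (rule RN(1))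
  show "A \<in> sets borel \<Longrightarrow> \<phi> (\<nu> A) = (LINT z:A|m. complex_RN_deriv m (\<lambda>A. \<phi> (\<nu> A)) z)"
    by (rule RN(2))
qed

text \<open>The vector integral is defined by testing against functionals, so \<phi> turns it into a
  complex measure integral, which the density converts into an integral over \<open>m\<close>. The
  work lies in the integrability of the product.\<close>

lemma vector_integral_eq_RN_deriv:
  fixes m :: "'a::t2_space measure" and \<nu> :: "'a set \<Rightarrow> 'x::complex_normed_vector"
  assumes m: "sets m = sets borel" "\<And>K. compact K \<Longrightarrow> emeasure m K < \<infinity>"
    and \<nu>: "\<nu> \<in> M_ac m" and \<phi>: "\<phi> \<in> complex_dual" and F: "F \<in> L1_vec \<nu>"
  shows "\<phi> (vector_integral \<nu> UNIV F) = (LINT z|m. complex_RN_deriv m (\<lambda>A. \<phi> (\<nu> A)) z * F z)"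
proof -
  define h where "h = complex_RN_deriv m (\<lambda>A. \<phi> (\<nu> A))"
  have h: "integrable m h" "\<And>A. A \<in> sets borel \<Longrightarrow> \<phi> (\<nu> A) = (LINT z:A|m. h z)"
    using M_ac_RN_deriv[OF m \<nu> \<phi>] by (auto simp: h_def)
  have hM[measurable]: "h \<in> borel_measurable m" using h by simp
  have FB: "F \<in> borel_measurable borel" using F by (auto simp: L1_vec_def L1_weak_def)
  have FM[measurable]: "F \<in> borel_measurable m" using FB measurable_cong_sets[OF m(1) refl] by auto
  obtain c where c: "0 < c" "(\<lambda>x. complex_of_real c * \<phi> x) \<in> complex_dual"
    "onorm (\<lambda>x. complex_of_real c * \<phi> x) \<le> 1"
    using complex_dual_scale_unit_ball[OF \<phi>] by blast
  \<comment> \<open>The rescaled functional competes in the supremum of \<open>L1_weak\<close>, so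
    its integral of the modulus of \<open>F\<close> is finite; dividing by \<open>c\<close>
    afterwards recovers \<phi>.\<close>
  have vm: "variation_measure (\<lambda>B. complex_of_real c * \<phi> (\<nu> B))
      = density m (\<lambda>z. ennreal (cmod (complex_of_real c * h z)))"
    by (rule variation_measure_eq_density[OF m(1)]) (use h in auto)
  have "(\<integral>\<^sup>+ z. ennreal (cmod (complex_of_real c * h z * F z)) \<partial>m)
      = (\<integral>\<^sup>+ z. ennreal (cmod (F z)) \<partial>variation_measure (\<lambda>B. complex_of_real c * \<phi> (\<nu> B)))"
    unfolding vm by (subst nn_integral_density) (auto simp: norm_mult ennreal_mult)
  also have "\<dots> \<le> (SUP \<psi>\<in>{\<psi> \<in> complex_dual. onorm \<psi> \<le> 1}.
        \<integral>\<^sup>+ z. ennreal (cmod (F z)) \<partial>variation_measure (\<lambda>B. \<psi> (\<nu> B)))"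
    by (rule SUP_upper2[of "\<lambda>x. complex_of_real c * \<phi> x"]) (use c in auto)
  also have "\<dots> < \<infinity>" using F by (simp add: L1_vec_def L1_weak_def)
  finally have "integrable m (\<lambda>z. complex_of_real c * h z * F z)"
    by (intro integrableI_bounded) auto
  then have "integrable m (\<lambda>z. complex_of_real (1 / c) * (complex_of_real c * h z * F z))"
    by (rule integrable_mult_right)
  then have hF: "integrable m (\<lambda>z. h z * F z)"
    using c(1) by (simp add: mult.assoc[symmetric])
  have "\<exists>v. is_vector_integral \<nu> UNIV F v"
    using F by (simp add: L1_vec_def)
  then have "is_vector_integral \<nu> UNIV F (vector_integral \<nu> UNIV F)"
    unfolding vector_integral_def by (rule someI_ex)
  then have "\<phi> (vector_integral \<nu> UNIV F) = complex_measure_integral (\<lambda>A. \<phi> (\<nu> A)) F"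
    using \<phi> by (simp add: is_vector_integral_def)
  also have "\<dots> = (LINT z|m. h z * F z)"
    by (rule complex_measure_integral_eq_density[OF m(1) h FB hF])
  finally show ?thesis by (simp add: h_def)
qed

theorem lemma5p7:
  fixes m :: "('g::{topological_ab_group_add, t2_space} \<times> 'g dual_group) measure"
    and \<nu> :: "('g \<times> 'g dual_group) set \<Rightarrow> 'x::operator_space"
    and f g :: "'g \<times> 'g dual_group \<Rightarrow> complex"
    and p :: real
  assumes "locally_compact_space (euclidean :: 'g topology)"
    and "haar_measure m"
    and "\<nu> \<in> M_ac m"
    and "1 \<le> p"
    and "f \<in> Lp m p"
    and "g \<in> L1_weak \<nu>"
    and "AE z in m. twisted_integrand f g z \<in> L1_vec \<nu>"
  shows "\<forall>\<phi>\<in>complex_dual. AE z in m.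
           twisted_conv_weak m \<nu> f g \<phi> z = \<phi> (twisted_conv_vec \<nu> f g z)"
proof
  fix \<phi> :: "'x \<Rightarrow> complex" assume \<phi>: "\<phi> \<in> complex_dual"
  have m: "sets m = sets borel" "\<And>K. compact K \<Longrightarrow> emeasure m K < \<infinity>"
    using \<open>haar_measure m\<close> by (auto simp: haar_measure_def)
  show "AE z in m. twisted_conv_weak m \<nu> f g \<phi> z = \<phi> (twisted_conv_vec \<nu> f g z)"
    using assms(7)
  proof (rule AE_mp, intro AE_I2 impI)
    \<comment> \<open>The exceptional null set is the one of the hypothesis, the same for every
      \<phi>. At the remaining points the conditional in \<open>twisted_conv_vec\<close> yields the
      vector integral, and the two integrands over \<open>m\<close> differ only in the order of
      their factors.\<close>
    fix z assume z: "twisted_integrand f g z \<in> L1_vec \<nu>"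
    have "twisted_conv_weak m \<nu> f g \<phi> z
        = (LINT w|m. complex_RN_deriv m (\<lambda>A. \<phi> (\<nu> A)) w * twisted_integrand f g z w)"
      unfolding twisted_conv_weak_def twisted_conv_def twisted_integrand_def
      by (auto simp: case_prod_beta mult_ac intro!: Bochner_Integration.integral_cong)
    then show "twisted_conv_weak m \<nu> f g \<phi> z = \<phi> (twisted_conv_vec \<nu> f g z)"
      using vector_integral_eq_RN_deriv[OF m \<open>\<nu> \<in> M_ac m\<close> \<phi> z] z
      by (simp add: twisted_conv_vec_def)
  qed
qed

end
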